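(* Let $\Lambda>0$, $0\le\alpha\le1$ and $c\ge0$. There exists a global stable manifold at the origin for $X_c$, given by a trajectory of $X_c$ in $Q=\{x\ge0,\ y\le0\}$ converging toward the origin in the positive direction of time. The orbit defined by this trajectory (its geometrical image) is the graph of a function $y=y(x)$ with $x\in(0,+\infty)$. This function is analytic for $x>0$ and extends continuously at $0$ with the value $y(0)=0$. Its graph is located above the curve $L_0=\{y=y_0(x)\}$; more precisely, $y_0(x)<y(x)<0$ for all $x>0$, where $$y_0(x)=-\Big(\frac{2}{\Lambda(1+\alpha)}\Big)^{1/2}x^{\frac{1+\alpha}{2}}.$$
   Context: $X_c$ is the vector field on $Q=\{(x,y):x\ge0,\ y\le0\}$ with differential system $x'=y$, $y'=\frac1\Lambda(cy+x^\alpha)$. Its only critical point is the origin $O=(0,0)$ (when $\alpha=0$, $x^\alpha$ is read as $1$ for $x>0$ and $0$ at $x=0$). A trajectory converges toward the origin in the positive direction of time if it tends to $O$ as $t$ tends to the (finite or infinite) upper end of its maximal interval of definition outside $O$. The curve $L_0$ is the stable manifold in $Q$ at the origin of the vector field $X_0$ (the case $c=0$).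
   Formalization: The strict inequality y_0(x) < y(x) is stated only for c > 0; for c = 0 it is false, since the stable manifold of X_0 is L_0 itself, and the equality y = y_0 is stated there instead. *)

theory Defs
  imports "HOL-Analysis.Analysis"
begin

definition Q :: "(real \<times> real) set" where
  "Q = {(x, y). 0 \<le> x \<and> y \<le> 0}"

(* For \<alpha> = 0 the library convention 0 powr 0 = 0 (and x powr 0 = 1 for x > 0) is
   exactly the required reading of x^0 on x \<ge> 0, so the origin is always critical. *)
definition X :: "real \<Rightarrow> real \<Rightarrow> real \<Rightarrow> real \<times> real \<Rightarrow> real \<times> real" where
  "X \<Lambda> \<alpha> c = (\<lambda>(x, y). (y, (1 / \<Lambda>) * (c * y + x powr \<alpha>)))"

(* Intervals may be open or closed at either end, since orbits can leave Q through its
   boundary; derivatives at end points that belong to I are one-sided.  Degenerate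
   intervals are excluded because the differential equation is vacuous on them. *)
definition solution_on ::
  "real \<Rightarrow> real \<Rightarrow> real \<Rightarrow> real set \<Rightarrow> (real \<Rightarrow> real \<times> real) \<Rightarrow> bool" where
  "solution_on \<Lambda> \<alpha> c I \<gamma> \<longleftrightarrow>
     is_interval I \<and> interior I \<noteq> {} \<and>
     (\<forall>t\<in>I. \<gamma> t \<in> Q - {(0, 0)} \<and>
            (\<gamma> has_vector_derivative X \<Lambda> \<alpha> c (\<gamma> t)) (at t within I))"

definition trajectory ::
  "real \<Rightarrow> real \<Rightarrow> real \<Rightarrow> real set \<Rightarrow> (real \<Rightarrow> real \<times> real) \<Rightarrow> bool" where
  "trajectory \<Lambda> \<alpha> c I \<gamma> \<longleftrightarrow>
     solution_on \<Lambda> \<alpha> c I \<gamma> \<and>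
     (\<forall>J \<delta>. solution_on \<Lambda> \<alpha> c J \<delta> \<and> I \<subseteq> J \<and> (\<forall>t\<in>I. \<delta> t = \<gamma> t) \<longrightarrow> J = I)"

(* The upper end of I is taken in the extended reals, so it may be finite or infinite. *)
definition converges_to_origin :: "real set \<Rightarrow> (real \<Rightarrow> real \<times> real) \<Rightarrow> bool" where
  "converges_to_origin I \<gamma> \<longleftrightarrow>
     ((\<lambda>t. \<gamma> (real_of_ereal t)) \<longlongrightarrow> (0, 0)) (at_left (SUP t\<in>I. ereal t))"

(* The origin itself is not included: all points lie on trajectories outside O. *)
definition stable_manifold :: "real \<Rightarrow> real \<Rightarrow> real \<Rightarrow> (real \<times> real) set" where
  "stable_manifold \<Lambda> \<alpha> c =
     \<Union> {\<gamma> ` I | I \<gamma>. trajectory \<Lambda> \<alpha> c I \<gamma> \<and> converges_to_origin I \<gamma>}"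

definition L0 :: "real \<Rightarrow> real \<Rightarrow> (real \<times> real) set" where
  "L0 \<Lambda> \<alpha> = stable_manifold \<Lambda> \<alpha> 0"

definition y0 :: "real \<Rightarrow> real \<Rightarrow> real \<Rightarrow> real" where
  "y0 \<Lambda> \<alpha> x = - sqrt (2 / (\<Lambda> * (1 + \<alpha>))) * x powr ((1 + \<alpha>) / 2)"

definition graph_pos :: "(real \<Rightarrow> real) \<Rightarrow> (real \<times> real) set" where
  "graph_pos f = {(x, f x) | x. 0 < x}"

(* The library's analytic_on is restricted to complex functions. *)
definition real_analytic_on :: "(real \<Rightarrow> real) \<Rightarrow> real set \<Rightarrow> bool" where
  "real_analytic_on f S \<longleftrightarrow> (\<forall>a\<in>S. \<exists>F. (\<lambda>h. f (a + h)) has_fps_expansion F)"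

end

theory Submission
  imports Defs "HOL-Complex_Analysis.Complex_Analysis"
begin

text \<open>Below the axis write an orbit as \<open>y = - u(x)\<close>; then
  \<open>u' = x\<^sup>\<alpha> / (\<Lambda> u) - c / \<Lambda>\<close>, whose right-hand side decreases in \<open>u\<close>. Hence
  solutions are ordered and the distance of two solutions does not increase with \<open>x\<close>. The solutions
  that leave the curve \<open>- y0\<close> at \<open>x = 1/n\<close> stay below it and decrease with \<open>n\<close>; their limit is the
  wanted \<open>u\<close>. Near any point it coincides with a local solution, and holomorphic Picard iteration
  makes local solutions analytic. A solution of the system that converges to the origin stays in the
  open quadrant, and along it \<open>(y\<^sup>2 - u(x)\<^sup>2)\<^sup>2\<close> is nondecreasing and tends to \<open>0\<close>, so it runs in the
  graph.\<close>

section \<open>Holomorphic Picard iteration\<close>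

text \<open>The obstacle is the origin: the orbit equation is singular at \<open>u = 0\<close>, so
  no initial value problem can be posed there. Hence the approximations start at \<open>1/n\<close>,
  on \<open>- y0\<close>, which is the exact solution for \<open>c = 0\<close>. For
  \<open>c \<ge> 0\<close> the term \<open>- c / \<Lambda>\<close> only lowers the slope, so
  \<open>- y0\<close> is an upper barrier; it orders the approximations and squeezes the limit to 0
  at the origin. Positivity of the limit needs a lower barrier that does not depend on
  \<open>n\<close>. For \<open>c = 0\<close> the quantity \<open>y^2 - u(x)^2\<close> is a
  difference of energies and is constant along solutions. For \<open>c > 0\<close> the sign of its
  derivative depends on the side of the graph; the outer square removes this dependence, so both
  sides are handled at once. The strict inequality against \<open>y0\<close> can hold only for
  \<open>c > 0\<close>: for \<open>c = 0\<close> the orbit is \<open>L0\<close> itself, and the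
  conclusion is split accordingly.\<close>

lemma holomorphic_primitive_on_ball:
  fixes a v :: complex and r :: real
  assumes r: "0 < r" and g: "g holomorphic_on ball a r"
    and bd: "\<And>z. z \<in> ball a r \<Longrightarrow> norm (g z) \<le> M"
    and re: "a \<in> \<real>" "v \<in> \<real>" "\<And>z. z \<in> ball a r \<Longrightarrow> z \<in> \<real> \<Longrightarrow> g z \<in> \<real>"
  obtains f where "f a = v" "\<And>z. z \<in> ball a r \<Longrightarrow> (f has_field_derivative g z) (at z)"
    "\<And>z. z \<in> ball a r \<Longrightarrow> norm (f z - v) \<le> M * r"
    "\<And>z. z \<in> ball a r \<Longrightarrow> z \<in> \<real> \<Longrightarrow> f z \<in> \<real>"
proof -
  obtain h where h: "\<And>x. x \<in> ball a r \<Longrightarrow> (h has_field_derivative g x) (at x within ball a r)"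
    using holomorphic_convex_primitive'[OF convex_ball open_ball g] by blast
  define f where "f z = h z - h a + v" for z
  have d: "(f has_field_derivative g z) (at z)" if "z \<in> ball a r" for z
  proof -
    have "(h has_field_derivative g z) (at z)"
      using h[OF that] that by (simp add: at_within_open[of z "ball a r"])
    then have "((\<lambda>z. h z - h a + v) has_field_derivative g z - 0 + 0) (at z)"
      by (intro derivative_intros)
    then show ?thesis unfolding f_def by simp
  qed
  have fa: "f a = v" by (simp add: f_def)
  have aa: "a \<in> ball a r" using r by simp
  have M0: "0 \<le> M" using bd[OF aa] norm_ge_zero order_trans by blast
  have b: "norm (f z - v) \<le> M * r" if "z \<in> ball a r" for z
  proof -
    have "norm (f z - f a) \<le> M * norm (z - a)"
      by (rule field_differentiable_bound[of "ball a r" f g])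
        (use d bd that aa in \<open>auto intro: has_field_derivative_at_within\<close>)
    also have "\<dots> \<le> M * r" using that M0
      by (intro mult_left_mono) (auto simp: dist_norm norm_minus_commute)
    finally show ?thesis by (simp add: fa)
  qed
  \<comment> \<open>On the real diameter \<open>Im f\<close> has derivative \<open>Im g = 0\<close>,
    and it vanishes at the centre.\<close>
  have real: "f z \<in> \<real>" if z: "z \<in> ball a r" "z \<in> \<real>" for z
  proof -
    obtain a' where a': "a = of_real a'" using re by (auto elim: Reals_cases)
    obtain z' where z': "z = of_real z'" using z by (auto elim: Reals_cases)
    define S where "S = ball a' r"
    have S: "of_real t \<in> ball a r" if "t \<in> S" for t :: real
      using that by (simp add: S_def a' dist_norm flip: of_real_diff)
    have D: "((\<lambda>t. Im (f (of_real t))) has_field_derivative 0) (at t within S)" if "t \<in> S" for t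
    proof -
      have "((\<lambda>t. f (of_real t)) has_vector_derivative g (of_real t)) (at t)"
        using d[OF S[OF that]] by (rule has_vector_derivative_real_field)
      then have "((\<lambda>t. Im (f (of_real t))) has_vector_derivative Im (g (of_real t))) (at t)"
        by (rule bounded_linear.has_vector_derivative[OF bounded_linear_Im])
      moreover have "Im (g (of_real t)) = 0"
        using re(3)[OF S[OF that]] by (simp add: complex_is_Real_iff)
      ultimately show ?thesis
        by (simp add: has_real_derivative_iff_has_vector_derivative has_vector_derivative_at_within)
    qed
    have "\<exists>k. \<forall>t\<in>S. Im (f (of_real t)) = k"
      by (rule has_field_derivative_zero_constant[OF _ D]) (auto simp: S_def)
    moreover have "a' \<in> S" using r by (simp add: S_def)
    moreover have "z' \<in> S" using z by (simp add: S_def a' z' dist_norm flip: of_real_diff)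
    ultimately have "Im (f z) = Im (f a)" unfolding a' z' by auto
    then show ?thesis using re fa by (simp add: complex_is_Real_iff)
  qed
  show ?thesis using that fa d b real by blast
qed

text \<open>\<open>M * r \<le> b\<close> keeps the iterates in the value ball and
  \<open>L * r \<le> 1/2\<close> makes the iteration a contraction. The hypothesis
  \<open>hol\<close> speaks of composites \<open>G z (f z)\<close>, so holomorphy in one variable
  suffices. Reality is carried along to return to a real solution later.\<close>

lemma holomorphic_picard:
  fixes a v :: complex and r b M L :: real and G :: "complex \<Rightarrow> complex \<Rightarrow> complex"
  assumes r: "0 < r" and b: "0 \<le> b"
    and hol: "\<And>f. f holomorphic_on ball a r \<Longrightarrow> f ` ball a r \<subseteq> cball v b \<Longrightarrow>
                (\<lambda>z. G z (f z)) holomorphic_on ball a r"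
    and bd: "\<And>z w. z \<in> ball a r \<Longrightarrow> w \<in> cball v b \<Longrightarrow> norm (G z w) \<le> M"
    and lip: "\<And>z w w'. z \<in> ball a r \<Longrightarrow> w \<in> cball v b \<Longrightarrow> w' \<in> cball v b \<Longrightarrow>
                norm (G z w - G z w') \<le> L * norm (w - w')"
    and L0: "0 \<le> L" and Mr: "M * r \<le> b" and Lr: "L * r \<le> 1/2"
    and re: "a \<in> \<real>" "v \<in> \<real>"
            "\<And>z w. z \<in> ball a r \<Longrightarrow> w \<in> cball v b \<Longrightarrow> z \<in> \<real> \<Longrightarrow> w \<in> \<real> \<Longrightarrow> G z w \<in> \<real>"
  obtains f where "f a = v" "f ` ball a r \<subseteq> cball v b"
    "\<And>z. z \<in> ball a r \<Longrightarrow> (f has_field_derivative G z (f z)) (at z)"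
    "\<And>z. z \<in> ball a r \<Longrightarrow> z \<in> \<real> \<Longrightarrow> f z \<in> \<real>"
proof -
  define good where "good f \<longleftrightarrow> f a = v \<and> f holomorphic_on ball a r \<and> f ` ball a r \<subseteq> cball v b
      \<and> (\<forall>z\<in>ball a r. z \<in> \<real> \<longrightarrow> f z \<in> \<real>)" for f
  define step where
    "step f g \<longleftrightarrow> (\<forall>z\<in>ball a r. (g has_field_derivative G z (f z)) (at z))" for f g
  \<comment> \<open>Primitives are given only by existence, so the iterates are chosen one after the
    other, starting from the constant \<open>v\<close>.\<close>
  have "\<exists>F. \<forall>n::nat. good (F n) \<and> step (F n) (F (Suc n))"
  proof (rule dependent_nat_choice)
    show "\<exists>f. good f"
      by (rule exI[of _ "\<lambda>_. v"]) (use b re in \<open>auto simp: good_def\<close>)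
  next
    fix f and n :: nat assume f: "good f"
    then have in_cball: "f z \<in> cball v b" if "z \<in> ball a r" for z
      using that unfolding good_def by blast
    obtain g where g: "g a = v" "\<And>z. z \<in> ball a r \<Longrightarrow> (g has_field_derivative G z (f z)) (at z)"
      "\<And>z. z \<in> ball a r \<Longrightarrow> norm (g z - v) \<le> M * r"
      "\<And>z. z \<in> ball a r \<Longrightarrow> z \<in> \<real> \<Longrightarrow> g z \<in> \<real>"
    proof (rule holomorphic_primitive_on_ball[OF r _ _ re(1,2)])
      show "(\<lambda>z. G z (f z)) holomorphic_on ball a r" using f hol unfolding good_def by blast
      show "norm (G z (f z)) \<le> M" if "z \<in> ball a r" for z using bd in_cball that by blast
      show "G z (f z) \<in> \<real>" if "z \<in> ball a r" "z \<in> \<real>" for z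
        using re(3) in_cball that f unfolding good_def by blast
    qed blast
    have "g holomorphic_on ball a r"
      by (rule holomorphic_onI) (meson g(2) has_field_derivative_at_within field_differentiable_def)
    moreover have "g ` ball a r \<subseteq> cball v b"
      using g(3) Mr by (fastforce simp: dist_norm norm_minus_commute)
    ultimately show "\<exists>g. good g \<and> step f g" using g unfolding good_def step_def by blast
  qed
  then obtain F where F: "\<And>n. good (F n)" "\<And>n. step (F n) (F (Suc n))" by blast
  have Fin: "F n z \<in> cball v b" if "z \<in> ball a r" for n z
    using F(1)[of n] that unfolding good_def by blast
  \<comment> \<open>The first gap is at most the diameter \<open>2 * b\<close> of the value ball.
    All iterates agree at \<open>a\<close>, so the mean value bound turns the Lipschitz estimate
    into a factor \<open>L * r \<le> 1/2\<close>.\<close>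
  have diff: "norm (F (Suc n) z - F n z) \<le> 2 * b * (1/2)^n" if "z \<in> ball a r" for n z
    using that
  proof (induction n arbitrary: z)
    case 0
    have "dist (F (Suc 0) z) (F 0 z) \<le> dist v (F (Suc 0) z) + dist v (F 0 z)"
      by (rule dist_triangle3)
    also have "\<dots> \<le> b + b"
      using Fin[OF 0, of 0] Fin[OF 0, of "Suc 0"] by (intro add_mono) auto
    finally show ?case by (simp add: dist_norm)
  next
    case (Suc n)
    have "norm ((F (Suc (Suc n)) z - F (Suc n) z) - (F (Suc (Suc n)) a - F (Suc n) a))
        \<le> (L * (2 * b * (1/2)^n)) * norm (z - a)"
    proof (rule field_differentiable_bound[of "ball a r" _ "\<lambda>z. G z (F (Suc n) z) - G z (F n z)"])
      fix w assume w: "w \<in> ball a r"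
      show "((\<lambda>z. F (Suc (Suc n)) z - F (Suc n) z) has_field_derivative
           G w (F (Suc n) w) - G w (F n w)) (at w within ball a r)"
        using F(2)[of n] F(2)[of "Suc n"] w unfolding step_def
        by (intro derivative_intros) (auto intro: has_field_derivative_at_within)
      have "norm (G w (F (Suc n) w) - G w (F n w)) \<le> L * norm (F (Suc n) w - F n w)"
        using lip w Fin by blast
      also have "\<dots> \<le> L * (2 * b * (1/2)^n)" using Suc.IH[OF w] L0 by (rule mult_left_mono)
      finally show "norm (G w (F (Suc n) w) - G w (F n w)) \<le> L * (2 * b * (1/2)^n)" .
    qed (use Suc.prems r in auto)
    also have "\<dots> \<le> (L * (2 * b * (1/2)^n)) * r"
      using Suc.prems L0 b by (intro mult_left_mono) (auto simp: dist_norm norm_minus_commute)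
    also have "\<dots> = (L * r) * (2 * b * (1/2)^n)" by simp
    also have "\<dots> \<le> 1/2 * (2 * b * (1/2)^n)" using Lr b by (intro mult_right_mono) auto
    finally show ?case using F(1) unfolding good_def by simp
  qed
  \<comment> \<open>The limit is written as a telescoping series so that the M-test yields uniform
    convergence.\<close>
  define f where "f z = F 0 z + (\<Sum>i. F (Suc i) z - F i z)" for z
  have "uniform_limit (ball a r) (\<lambda>n z. \<Sum>i<n. F (Suc i) z - F i z)
          (\<lambda>z. \<Sum>i. F (Suc i) z - F i z) sequentially"
    by (rule Weierstrass_m_test[OF diff]) (auto intro!: summable_mult summable_geometric)
  then have "uniform_limit (ball a r) (\<lambda>n z. F 0 z + (\<Sum>i<n. F (Suc i) z - F i z)) f sequentially"
    unfolding f_def by (intro uniform_limit_add uniform_limit_const)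
  moreover have "F 0 z + (\<Sum>i<n. F (Suc i) z - F i z) = F n z" for n z
    using sum_lessThan_telescope[of "\<lambda>i. F i z" n] by simp
  ultimately have ul: "uniform_limit (ball a r) F f sequentially" by simp
  have lim: "(\<lambda>n. F n z) \<longlonglongrightarrow> f z" if "z \<in> ball a r" for z
    using tendsto_uniform_limitI[OF ul that] .
  have fin: "f z \<in> cball v b" if "z \<in> ball a r" for z
    by (rule Lim_in_closed_set[OF closed_cball _ _ lim[OF that]]) (use Fin that in auto)
  \<comment> \<open>The derivative of \<open>F (Suc n)\<close> is \<open>G x (F n x)\<close>, hence
    the shift. Uniform convergence of holomorphic functions passes to derivatives, and the Lipschitz
    bound identifies their limit as \<open>G x (f x)\<close>.\<close>
  have "\<exists>g'. \<forall>x\<in>ball a r. (f has_field_derivative g' x) (at x) \<and>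
          (\<lambda>n. G x (F n x)) \<longlonglongrightarrow> g' x"
  proof (rule has_complex_derivative_uniform_sequence[of "ball a r" "\<lambda>n. F (Suc n)"])
    show "(F (Suc n) has_field_derivative G x (F n x)) (at x)" if "x \<in> ball a r" for n x
      using F(2) that unfolding step_def by blast
    have ulS: "uniform_limit (ball a r) (\<lambda>n. F (Suc n)) f sequentially"
      using ul unfolding uniform_limit_iff
      using eventually_sequentially_Suc[of "\<lambda>n. \<forall>x\<in>ball a r. dist (F n x) (f x) < e" for e] by blast
    fix x assume "x \<in> ball a r"
    then obtain d where "d > 0" "cball x d \<subseteq> ball a r"
      by (meson open_ball open_contains_cball)
    then show "\<exists>d. 0 < d \<and> cball x d \<subseteq> ball a r
        \<and> uniform_limit (cball x d) (\<lambda>n. F (Suc n)) f sequentially"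
      using uniform_limit_on_subset[OF ulS] by blast
  qed simp
  then obtain g' where g': "\<And>x. x \<in> ball a r \<Longrightarrow> (f has_field_derivative g' x) (at x)"
    "\<And>x. x \<in> ball a r \<Longrightarrow> (\<lambda>n. G x (F n x)) \<longlonglongrightarrow> g' x" by blast
  have "g' z = G z (f z)" if z: "z \<in> ball a r" for z
  proof -
    have "(\<lambda>n. G z (F n z) - G z (f z)) \<longlonglongrightarrow> 0"
    proof (rule Lim_null_comparison)
      show "\<forall>\<^sub>F n in sequentially. norm (G z (F n z) - G z (f z)) \<le> L * norm (F n z - f z)"
        using lip[OF z Fin[OF z] fin[OF z]] by simp
      have "(\<lambda>n. norm (F n z - f z)) \<longlonglongrightarrow> 0"
        using lim[OF z] by (simp add: LIM_zero tendsto_norm_zero)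
      then show "(\<lambda>n. L * norm (F n z - f z)) \<longlonglongrightarrow> 0" by (rule tendsto_mult_right_zero)
    qed
    then have "(\<lambda>n. G z (F n z)) \<longlonglongrightarrow> G z (f z)" by (rule LIM_zero_cancel)
    then show ?thesis using g'(2)[OF z] LIMSEQ_unique by blast
  qed
  then have d: "(f has_field_derivative G z (f z)) (at z)" if "z \<in> ball a r" for z
    using g'(1)[OF that] that by simp
  have "a \<in> ball a r" using r by simp
  then have fa: "f a = v" using lim[of a] F(1) unfolding good_def by (simp add: LIMSEQ_const_iff)
  have "f z \<in> \<real>" if "z \<in> ball a r" "z \<in> \<real>" for z
    by (rule Lim_in_closed_set[OF closed_complex_Reals _ _ lim])
      (use F(1) that in \<open>auto simp: good_def\<close>)
  then show ?thesis using that fa fin d by blast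
qed

text \<open>Powers of a real argument are real, so real parts may be taken coefficientwise. The new
  series converges at every real point inside the old radius, so the radius does not shrink.\<close>

lemma has_fps_expansion_Re:
  fixes f :: "complex \<Rightarrow> complex"
  assumes f: "f has_fps_expansion F"
  shows "(\<lambda>x::real. Re (f (of_real x))) has_fps_expansion Abs_fps (\<lambda>n. Re (fps_nth F n))"
proof -
  let ?R = "Abs_fps (\<lambda>n. Re (fps_nth F n))"
  have pos: "fps_conv_radius F > 0" and ev: "\<forall>\<^sub>F z in nhds 0. eval_fps F z = f z"
    using f by (auto simp: has_fps_expansion_def)
  have sums: "(\<lambda>n. fps_nth ?R n * x ^ n) sums Re (eval_fps F (of_real x))"
    if "ereal \<bar>x\<bar> < fps_conv_radius F" for x
  proof -
    have "summable (\<lambda>n. fps_nth F n * of_real x ^ n)"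
      by (rule summable_fps) (use that in simp)
    then have "(\<lambda>n. fps_nth F n * of_real x ^ n) sums eval_fps F (of_real x)"
      by (simp add: eval_fps_def summable_sums)
    then have "(\<lambda>n. Re (fps_nth F n * of_real x ^ n)) sums Re (eval_fps F (of_real x))"
      by (rule bounded_linear.sums[OF bounded_linear_Re])
    then show ?thesis by (simp flip: of_real_power)
  qed
  have "fps_conv_radius F \<le> fps_conv_radius ?R"
    unfolding fps_conv_radius_def[of ?R]
  proof (rule conv_radius_geI_ex')
    fix r :: real assume "0 < r" "ereal r < fps_conv_radius F"
    then show "summable (\<lambda>n. fps_nth ?R n * of_real r ^ n)"
      using sums_summable[OF sums[of r]] by simp
  qed
  moreover have "\<forall>\<^sub>F x in nhds 0. eval_fps ?R x = Re (f (of_real x))"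
  proof -
    have "\<forall>\<^sub>F x::real in nhds 0. eval_fps F (of_real x) = f (of_real x)"
      by (rule eventually_compose_filterlim[OF ev])
        (use tendsto_of_real[OF filterlim_ident, of "0::real"] in simp)
    moreover have "\<forall>\<^sub>F x::real in nhds 0. x \<in> eball 0 (fps_conv_radius F)"
      by (rule eventually_nhds_in_open) (use pos in \<open>auto simp: zero_ereal_def\<close>)
    ultimately show ?thesis
    proof eventually_elim
      case (elim x)
      then show ?case using sums[of x] by (simp add: eval_fps_def sums_iff)
    qed
  qed
  ultimately show ?thesis using pos by (auto simp: has_fps_expansion_def)
qed

lemma real_analytic_on_cong:
  assumes "open S" "\<And>x. x \<in> S \<Longrightarrow> f x = g x" "real_analytic_on g S"
  shows "real_analytic_on f S"
  unfolding real_analytic_on_def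
proof
  fix x assume x: "x \<in> S"
  then obtain F where F: "(\<lambda>h. g (x + h)) has_fps_expansion F"
    using assms(3) unfolding real_analytic_on_def by blast
  have "\<forall>\<^sub>F t in nhds x. f t = g t"
    using assms(1,2) x by (auto intro: eventually_mono[OF eventually_nhds_in_open])
  then have "\<forall>\<^sub>F h in nhds 0. f (x + h) = g (x + h)"
    by (simp add: nhds_to_0'[of x] eventually_filtermap)
  then have "(\<lambda>h. f (x + h)) has_fps_expansion F"
    using F by (simp add: has_fps_expansion_cong[OF _ refl])
  then show "\<exists>F. (\<lambda>h. f (x + h)) has_fps_expansion F" by blast
qed

lemma real_analytic_on_minus:
  "real_analytic_on f S \<Longrightarrow> real_analytic_on (\<lambda>x. - f x) S"
  unfolding real_analytic_on_def using has_fps_expansion_minus[of "\<lambda>h. f (_ + h)"] by fast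

text \<open>Barrier principle behind the comparisons below. After the last point \<open>s\<close>
  with \<open>0 \<le> d s\<close> the function is negative, hence nondecreasing, which gives
  \<open>d s \<le> d b\<close>.\<close>

lemma nonneg_if_nondecreasing_below_0:
  fixes d :: "real \<Rightarrow> real"
  assumes ab: "a \<le> b" and cont: "continuous_on {a..b} d" and a: "0 \<le> d a"
    and inc: "\<And>x. a < x \<Longrightarrow> x < b \<Longrightarrow> d x < 0 \<Longrightarrow> \<exists>D\<ge>0. (d has_real_derivative D) (at x)"
  shows "0 \<le> d b"
proof (rule ccontr)
  assume neg: "\<not> 0 \<le> d b"
  define S where "S = {a..b} \<inter> d -` {0..}"
  have "closed S" unfolding S_def by (rule continuous_closed_preimage[OF cont]) auto
  moreover have "bounded S" by (rule bounded_subset[of "{a..b}"]) (auto simp: S_def)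
  ultimately have "compact S" by (simp add: compact_eq_bounded_closed)
  moreover have "a \<in> S" using a ab by (simp add: S_def)
  ultimately obtain s where s: "s \<in> S" "\<And>x. x \<in> S \<Longrightarrow> x \<le> s"
    using compact_attains_sup[of S] by blast
  have "d s \<le> d b"
  proof (rule DERIV_nonneg_imp_increasing_open[of s b d])
    show "s \<le> b" using s by (simp add: S_def)
    show "continuous_on {s..b} d"
      using s by (intro continuous_on_subset[OF cont]) (auto simp: S_def)
    fix x assume x: "s < x" "x < b"
    have "d x < 0"
    proof (rule ccontr)
      assume "\<not> d x < 0"
      then have "x \<in> S" using x s(1) by (simp add: S_def)
      then show False using s(2)[of x] x by simp
    qed
    then show "\<exists>y. DERIV d x :> y \<and> y \<ge> 0" using inc[of x] x s by (auto simp: S_def)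
  qed
  then show False using s(1) neg by (auto simp: S_def)
qed

section \<open>The scalar equation of the orbits\<close>

locale saddle =
  fixes \<Lambda> \<alpha> c :: real
  assumes \<Lambda>: "\<Lambda> > 0" and \<alpha>: "0 \<le> \<alpha>" "\<alpha> \<le> 1" and c: "c \<ge> 0"
begin

definition slope :: "real \<Rightarrow> real \<Rightarrow> real" where
  "slope x w = x powr \<alpha> / (\<Lambda> * w) - c / \<Lambda>"

text \<open>Positivity is built in because at \<open>w = 0\<close> the division convention would
  turn \<open>slope x w\<close> into \<open>- c / \<Lambda>\<close>. Derivatives are one-sided at
  the end points, which permits gluing.\<close>

definition sol :: "real \<Rightarrow> real \<Rightarrow> (real \<Rightarrow> real) \<Rightarrow> bool" where
  "sol a b u \<longleftrightarrow>
     (\<forall>x\<in>{a..b}. 0 < u x \<and> (u has_real_derivative slope x (u x)) (at x within {a..b}))"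

lemma slope_antimono: "0 < v \<Longrightarrow> v \<le> w \<Longrightarrow> slope x w \<le> slope x v"
  unfolding slope_def using \<Lambda> by (intro diff_right_mono divide_left_mono mult_left_mono) auto

lemma sol_pos: "sol a b u \<Longrightarrow> x \<in> {a..b} \<Longrightarrow> 0 < u x"
  by (simp add: sol_def)

lemma sol_continuous: "sol a b u \<Longrightarrow> continuous_on {a..b} u"
  unfolding sol_def by (intro DERIV_continuous_on) auto

lemma sol_deriv: "sol a b u \<Longrightarrow> a < x \<Longrightarrow> x < b \<Longrightarrow> (u has_real_derivative slope x (u x)) (at x)"
  by (metis at_within_Icc_at atLeastAtMost_iff less_imp_le sol_def)

lemma sol_subset: "sol a b u \<Longrightarrow> a \<le> a' \<Longrightarrow> b' \<le> b \<Longrightarrow> sol a' b' u"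
  unfolding sol_def
  by (auto intro!: has_field_derivative_subset[of u _ _ "{a..b}" "{a'..b'}"])

text \<open>There is no kink at \<open>b\<close>: both one-sided derivatives equal
  \<open>slope b (u b)\<close>.\<close>

lemma sol_glue:
  assumes u: "sol a b u" and w: "sol b b' w" and eq: "u b = w b" and ab: "a \<le> b" "b \<le> b'"
  shows "sol a b' (\<lambda>x. if x \<in> {a..b} then u x else w x)"
proof -
  let ?v = "\<lambda>x. if x \<in> {a..b} then u x else w x"
  have der: "(?v has_vector_derivative
         (if x \<in> {a..b} then slope x (u x) else slope x (w x))) (at x within {a..b'})"
    if "x \<in> {a..b'}" for x
  proof (rule has_vector_derivative_If_within_closures[where T = "{b..b'}"])
    have *: "closure {a..b} \<inter> closure {b..b'} = {b}" using ab by auto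
    show "x \<in> {a..b} \<union> {b..b'}" "{a..b'} = {a..b} \<union> {b..b'}" using that ab by auto
    show "(u has_vector_derivative slope x (u x))
        (at x within {a..b} \<union> (closure {a..b} \<inter> closure {b..b'}))"
      if "x \<in> {a..b} \<union> (closure {a..b} \<inter> closure {b..b'})"
      using that u ab unfolding * sol_def has_real_derivative_iff_has_vector_derivative
      by (auto simp: Un_absorb2 insert_absorb)
    show "(w has_vector_derivative slope x (w x))
        (at x within {b..b'} \<union> (closure {a..b} \<inter> closure {b..b'}))"
      if "x \<in> {b..b'} \<union> (closure {a..b} \<inter> closure {b..b'})"
      using that w ab unfolding * sol_def has_real_derivative_iff_has_vector_derivative
      by (auto simp: Un_absorb2 insert_absorb)
    show "u x = w x" "slope x (u x) = slope x (w x)"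
      if "x \<in> closure {a..b}" "x \<in> closure {b..b'}"
      using that eq by (auto dest!: antisym[of x b])
  qed
  have "0 < ?v x \<and> (?v has_vector_derivative slope x (?v x)) (at x within {a..b'})"
    if "x \<in> {a..b'}" for x
    using der[OF that] that u w unfolding sol_def by (cases "x \<in> {a..b}") simp_all
  then show ?thesis
    unfolding sol_def has_real_derivative_iff_has_vector_derivative by blast
qed

text \<open>Wherever \<open>v\<close> is below \<open>u\<close>, \<open>slope_antimono\<close> makes
  \<open>v\<close> grow at least as fast, so the gap \<open>v - u\<close> cannot become
  negative.\<close>

lemma sol_mono:
  assumes u: "sol a b u" and v: "sol a b v" and ab: "a \<le> b" and le: "u a \<le> v a"
  shows "u b \<le> v b"
proof -
  have "0 \<le> v b - u b"
  proof (rule nonneg_if_nondecreasing_below_0[OF ab])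
    show "continuous_on {a..b} (\<lambda>x. v x - u x)"
      using u v by (intro continuous_intros sol_continuous)
    fix x assume x: "a < x" "x < b" and neg: "v x - u x < 0"
    have "((\<lambda>x. v x - u x) has_real_derivative slope x (v x) - slope x (u x)) (at x)"
      using sol_deriv[OF u x] sol_deriv[OF v x] by (intro derivative_intros)
    moreover have "slope x (u x) \<le> slope x (v x)"
      using neg x sol_pos[OF v, of x] by (intro slope_antimono) auto
    ultimately show "\<exists>D\<ge>0. ((\<lambda>x. v x - u x) has_real_derivative D) (at x)" 
      by (metis diff_ge_0_iff_ge)
  qed (use le in simp)
  then show ?thesis by simp
qed

lemma sol_contraction:
  assumes u: "sol a b u" and v: "sol a b v" and ab: "a \<le> b" and le: "u a \<le> v a"
  shows "v b - u b \<le> v a - u a"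
proof -
  have "- (v a - u a) \<le> - (v b - u b)"
  proof (rule DERIV_nonneg_imp_increasing_open[OF ab])
    show "continuous_on {a..b} (\<lambda>x. - (v x - u x))"
      using u v by (intro continuous_intros sol_continuous)
    fix x assume x: "a < x" "x < b"
    have "((\<lambda>x. - (v x - u x)) has_real_derivative - (slope x (v x) - slope x (u x))) (at x)"
      using sol_deriv[OF u x] sol_deriv[OF v x] by (intro derivative_intros)
    moreover have "u x \<le> v x"
      by (rule sol_mono[of a x]) (use sol_subset[OF u] sol_subset[OF v] x le in auto)
    then have "slope x (v x) \<le> slope x (u x)"
      using x sol_pos[OF u, of x] by (intro slope_antimono) auto
    then have "0 \<le> - (slope x (v x) - slope x (u x))" by simp
    ultimately show "\<exists>y. ((\<lambda>x. - (v x - u x)) has_real_derivative y) (at x) \<and> 0 \<le> y" by blast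
  qed
  then show ?thesis by simp
qed

text \<open>Below the height \<open>m\<close> one has \<open>c * u x \<le> x powr \<alpha>\<close>,
  so the slope is nonnegative there. This keeps solutions away from the singular value 0 during
  continuation.\<close>

lemma sol_ge_floor:
  assumes u: "sol a b u" and ab: "0 < e" "e \<le> a" "a \<le> b"
    and m: "m \<le> u a" "c * m \<le> e powr \<alpha>"
  shows "m \<le> u b"
proof -
  have "0 \<le> u b - m"
  proof (rule nonneg_if_nondecreasing_below_0[OF ab(3)])
    show "continuous_on {a..b} (\<lambda>x. u x - m)"
      using u by (intro continuous_intros sol_continuous)
    fix x assume x: "a < x" "x < b" and neg: "u x - m < 0"
    have "((\<lambda>x. u x - m) has_real_derivative slope x (u x) - 0) (at x)"
      using sol_deriv[OF u x] by (intro derivative_intros)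
    moreover have "0 \<le> slope x (u x)"
    proof -
      have pos: "0 < u x" using sol_pos[OF u, of x] x by auto
      have "c * u x \<le> c * m" using neg c by (intro mult_left_mono) auto
      also have "\<dots> \<le> e powr \<alpha>" by (rule m)
      also have "\<dots> \<le> x powr \<alpha>" using ab x \<alpha> by (intro powr_mono2) auto
      finally show ?thesis using pos \<Lambda> unfolding slope_def by (simp add: field_simps)
    qed
    ultimately show "\<exists>D\<ge>0. ((\<lambda>x. u x - m) has_real_derivative D) (at x)" by auto
  qed (use m in simp)
  then show ?thesis by simp
qed

text \<open>The barrier starts at height 0, so it is below every positive solution at
  \<open>a\<close>. As \<open>\<delta>\<close> depends only on \<open>a\<close> and
  \<open>b\<close>, the bound survives the limit of the approximating solutions.\<close>

lemma sol_ge_linear: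
  assumes ab: "0 < a" "a < b"
  obtains \<delta> where "0 < \<delta>" "\<And>u s. a \<le> s \<Longrightarrow> s \<le> b \<Longrightarrow> sol a s u \<Longrightarrow> \<delta> * (s - a) \<le> u s"
proof -
  \<comment> \<open>Below the barrier \<open>u x \<le> \<delta> * (b - a)\<close>, and
    \<open>\<delta> \<le> 1\<close> bounds \<open>c + \<Lambda> * \<delta>\<close> by
    \<open>c + \<Lambda>\<close>. The quotient makes the product at most
    \<open>a powr \<alpha>\<close>, which is exactly
    \<open>\<delta> \<le> slope x (u x)\<close>.\<close>
  define \<delta> where "\<delta> = min 1 (a powr \<alpha> / ((b - a) * (c + \<Lambda>)))"
  have \<delta>: "0 < \<delta>" "\<delta> \<le> 1" using ab \<Lambda> c by (auto simp: \<delta>_def)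
  have "\<delta> \<le> a powr \<alpha> / ((b - a) * (c + \<Lambda>))" by (simp add: \<delta>_def)
  then have \<delta>b: "\<delta> * (b - a) * (c + \<Lambda>) \<le> a powr \<alpha>"
    using ab \<Lambda> c by (simp add: pos_le_divide_eq mult.assoc)
  have "\<delta> * (s - a) \<le> u s" if s: "a \<le> s" "s \<le> b" and u: "sol a s u" for u s
  proof -
    have "0 \<le> u s - \<delta> * (s - a)"
    proof (rule nonneg_if_nondecreasing_below_0[OF s(1)])
      show "continuous_on {a..s} (\<lambda>x. u x - \<delta> * (x - a))"
        using u by (intro continuous_intros sol_continuous)
      show "0 \<le> u a - \<delta> * (a - a)" using sol_pos[OF u, of a] s by simp
      fix x assume x: "a < x" "x < s" and neg: "u x - \<delta> * (x - a) < 0"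
      have "((\<lambda>x. u x - \<delta> * (x - a)) has_real_derivative slope x (u x) - \<delta> * (1 - 0)) (at x)"
        using sol_deriv[OF u x] by (intro derivative_intros DERIV_cmult) auto
      moreover have "\<delta> \<le> slope x (u x)"
      proof -
        have pos: "0 < u x" using sol_pos[OF u, of x] x by auto
        have "u x \<le> \<delta> * (x - a)" using neg by simp
        also have "\<dots> \<le> \<delta> * (b - a)" using x s \<delta> by (intro mult_left_mono) auto
        finally have "u x * (c + \<Lambda> * \<delta>) \<le> \<delta> * (b - a) * (c + \<Lambda>)"
          using \<delta> \<Lambda> c ab by (intro mult_mono) auto
        also note \<delta>b
        also have "a powr \<alpha> \<le> x powr \<alpha>" using ab x \<alpha> by (intro powr_mono2) auto
        finally show ?thesis using pos \<Lambda> unfolding slope_def by (simp add: field_simps)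
      qed
      then have "0 \<le> slope x (u x) - \<delta> * (1 - 0)" by simp
      ultimately show "\<exists>D\<ge>0. ((\<lambda>x. u x - \<delta> * (x - a)) has_real_derivative D) (at x)" by blast
    qed
    then show ?thesis by simp
  qed
  then show ?thesis using that \<delta>(1) by blast
qed

text \<open>The radius depends only on bounds for \<open>a\<close> and a lower bound for \<open>v\<close>; this uniformity is what
  allows continuation, and identification of the limit from a nearby point on its left.\<close>

lemma local_solution:
  assumes e: "0 < e" "e \<le> B" and m: "0 < m"
  obtains r where "0 < r" "r < e"
    "\<And>a v. e \<le> a \<Longrightarrow> a \<le> B \<Longrightarrow> m \<le> v \<Longrightarrow> \<exists>u. u a = v \<and> real_analytic_on u (ball a r) \<and>
       (\<forall>x\<in>ball a r. 0 < u x \<and> (u has_real_derivative slope x (u x)) (at x))"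
proof -
  \<comment> \<open>\<open>A\<close> bounds \<open>z powr \<alpha>\<close> on the discs, where
    \<open>norm z \<le> 2 * B\<close>. \<open>R\<close> bounds both the Lipschitz constant
    \<open>L\<close> and \<open>M / v\<close>. The radius \<open>r \<le> e / 2\<close> keeps the
    discs in the right half-plane, and \<open>R * r \<le> 1/2\<close> gives both Picard
    conditions.\<close>
  define A where "A = 1 + 2 * B"
  define R where "R = 4 * A / (\<Lambda> * m\<^sup>2) + c / (\<Lambda> * m)"
  define r where "r = min (e / 2) (1 / (2 * R))"
  have A: "1 < A" using e by (simp add: A_def)
  have "0 < 4 * A / (\<Lambda> * m\<^sup>2)" "0 \<le> c / (\<Lambda> * m)"
    using A \<Lambda> m c by (auto intro!: divide_pos_pos mult_pos_pos)
  then have R: "0 < R" "4 * A / (\<Lambda> * m\<^sup>2) \<le> R" by (auto simp: R_def)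
  have r: "0 < r" "r \<le> e / 2" "r \<le> 1 / (2 * R)" using e R by (auto simp: r_def)
  have rR: "R * r \<le> 1 / 2" using r(3) R by (simp add: field_simps)
  have "\<exists>u. u a = v \<and> real_analytic_on u (ball a r) \<and>
       (\<forall>x\<in>ball a r. 0 < u x \<and> (u has_real_derivative slope x (u x)) (at x))"
    if a: "e \<le> a" "a \<le> B" and v: "m \<le> v" for a v
  proof -
    define G :: "complex \<Rightarrow> complex \<Rightarrow> complex" where
      "G z w = z powr of_real \<alpha> / (of_real \<Lambda> * w) - of_real (c / \<Lambda>)" for z w
    \<comment> \<open>Values range over the ball of radius \<open>v / 2\<close> around
      \<open>v\<close>, where \<open>norm w \<ge> v / 2\<close>. Since this radius grows with
      \<open>v\<close>, the estimate \<open>M \<le> v * R\<close> gives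
      \<open>M * r \<le> v / 2\<close> for all \<open>v \<ge> m\<close> at once.\<close>
    define M where "M = A / (\<Lambda> * (v / 2)) + c / \<Lambda>"
    define L where "L = 4 * A / (\<Lambda> * v\<^sup>2)"
    have v0: "0 < v" using m v by simp
    have Re_z: "0 < Re z" if "z \<in> ball (of_real a) r" for z
      using that abs_Re_le_cmod[of "of_real a - z"] r a e by (simp add: dist_norm)
    have norm_powr: "norm (z powr of_real \<alpha>) \<le> A" if "z \<in> ball (of_real a) r" for z :: complex
    proof -
      have "norm z \<le> norm (of_real a :: complex) + dist (of_real a) z"
        using norm_triangle_sub[of z "of_real a"] by (simp add: dist_norm norm_minus_commute)
      then have nz: "norm z \<le> 2 * B" using that r a e by simp
      have "norm (z powr of_real \<alpha>) = norm z powr \<alpha>"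
        by (subst norm_powr_real_powr') auto
      also have "\<dots> \<le> A"
      proof (cases "norm z \<le> 1")
        case True
        then have "norm z powr \<alpha> \<le> 1" using \<alpha> by (intro powr_le1) auto
        then show ?thesis using A by simp
      next
        case False
        then have "norm z powr \<alpha> \<le> norm z powr 1" using \<alpha> by (intro powr_mono) auto
        then show ?thesis using nz False by (simp add: A_def)
      qed
      finally show ?thesis .
    qed
    have Re_w: "v / 2 \<le> Re w" if "w \<in> cball (of_real v) (v / 2)" for w :: complex
      using that abs_Re_le_cmod[of "of_real v - w"] by (simp add: dist_norm)
    then have norm_w: "v / 2 \<le> norm w" if "w \<in> cball (of_real v) (v / 2)" for w :: complex
      using that complex_Re_le_cmod[of w] order_trans by blast
    have L_le: "L \<le> R"
    proof -
      have "L \<le> 4 * A / (\<Lambda> * m\<^sup>2)" unfolding L_def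
        using \<Lambda> m v A by (intro divide_left_mono mult_left_mono power_mono) auto
      then show ?thesis using R by simp
    qed
    have M_le: "M \<le> v * R"
    proof -
      have "c / \<Lambda> = v * (c / (\<Lambda> * v))" using v0 by simp
      also have "\<dots> \<le> v * (c / (\<Lambda> * m))" using v0 m v c \<Lambda>
        by (intro mult_left_mono divide_left_mono) auto
      finally have 1: "c / \<Lambda> \<le> v * (c / (\<Lambda> * m))" .
      have "A / (\<Lambda> * (v / 2)) = v * (2 * A / (\<Lambda> * v\<^sup>2))"
        using v0 by (simp add: power2_eq_square)
      also have "\<dots> \<le> v * (4 * A / (\<Lambda> * m\<^sup>2))" using v0 m v A \<Lambda>
        by (intro mult_left_mono frac_le power_mono) auto
      finally show ?thesis using 1 unfolding M_def R_def by (simp add: distrib_left)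
    qed
    obtain f where f: "f (of_real a) = of_real v"
      "f ` ball (of_real a) r \<subseteq> cball (of_real v) (v / 2)"
      "\<And>z. z \<in> ball (of_real a) r \<Longrightarrow> (f has_field_derivative G z (f z)) (at z)"
      "\<And>z. z \<in> ball (of_real a) r \<Longrightarrow> z \<in> \<real> \<Longrightarrow> f z \<in> \<real>"
    proof (rule holomorphic_picard[of r "v / 2" "of_real a" "of_real v" G M L])
      fix z w :: complex
      assume z: "z \<in> ball (of_real a) r" and w: "w \<in> cball (of_real v) (v / 2)"
      have "norm (G z w) \<le> norm (z powr of_real \<alpha>) / (\<Lambda> * norm w) + c / \<Lambda>"
        unfolding G_def using \<Lambda> c
        by (intro order_trans[OF norm_triangle_ineq4]) (simp add: norm_divide norm_mult)
      also have "\<dots> \<le> M" unfolding M_def using norm_powr[OF z] norm_w[OF w] v0 \<Lambda> A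
        by (intro add_right_mono frac_le mult_left_mono) auto
      finally show "norm (G z w) \<le> M" .
      {
        assume "z \<in> \<real>" "w \<in> \<real>"
        then show "G z w \<in> \<real>" using powr_Reals_eq[of z "of_real \<alpha>"] Re_z[OF z]
          unfolding G_def by auto
      }
      fix w' :: complex assume w': "w' \<in> cball (of_real v) (v / 2)"
      have nz: "w \<noteq> 0" "w' \<noteq> 0" using norm_w[OF w] norm_w[OF w'] v0 by auto
      have "G z w - G z w' = z powr of_real \<alpha> * (w' - w) / (of_real \<Lambda> * (w * w'))"
        unfolding G_def using nz \<Lambda> by (simp add: field_simps)
      then have "norm (G z w - G z w')
          = norm (z powr of_real \<alpha>) * norm (w - w') / (\<Lambda> * (norm w * norm w'))"
        using \<Lambda> by (simp add: norm_mult norm_divide norm_minus_commute)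
      also have "\<dots> \<le> A * norm (w - w') / (\<Lambda> * (v / 2 * (v / 2)))"
        using norm_powr[OF z] norm_w[OF w] norm_w[OF w'] v0 \<Lambda> A
        by (intro frac_le mult_right_mono mult_left_mono mult_mono) auto
      also have "\<dots> = L * norm (w - w')"
        unfolding L_def by (simp add: power2_eq_square)
      finally show "norm (G z w - G z w') \<le> L * norm (w - w')" .
    next
      fix f assume f: "f holomorphic_on ball (of_real a) r"
        "f ` ball (of_real a) r \<subseteq> cball (of_real v) (v / 2)"
      show "(\<lambda>z. G z (f z)) holomorphic_on ball (of_real a) r"
        unfolding G_def
      proof (intro holomorphic_intros f)
        show "of_real \<Lambda> * f z \<noteq> 0" if "z \<in> ball (of_real a) r" for z
        proof -
          have "f z \<in> cball (of_real v) (v / 2)" using f(2) that by blast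
          from norm_w[OF this] show ?thesis using v0 \<Lambda> by auto
        qed
        show "z \<notin> \<real>\<^sub>\<le>\<^sub>0" if "z \<in> ball (of_real a) r" for z :: complex
          using Re_z[OF that] by (auto simp: complex_nonpos_Reals_iff)
      qed
    next
      have "M * r \<le> v * R * r" using M_le r by (intro mult_right_mono) auto
      also have "\<dots> = v * (R * r)" by simp
      also have "\<dots> \<le> v * (1 / 2)" using rR v0 by (intro mult_left_mono) auto
      finally show "M * r \<le> v / 2" by simp
      have "L * r \<le> R * r" using L_le r by (intro mult_right_mono) auto
      then show "L * r \<le> 1 / 2" using rR by simp
      show "0 \<le> L" unfolding L_def using A \<Lambda> by simp
    qed (use r v0 in auto)
    define u where "u x = Re (f (of_real x))" for x
    have ball: "of_real x \<in> ball (of_real a :: complex) r" if "x \<in> ball a r" for x :: real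
      using that by (simp add: dist_norm flip: of_real_diff)
    have fu: "f (of_real x) = of_real (u x)" if "x \<in> ball a r" for x
      unfolding u_def using f(4)[OF ball[OF that]] by simp
    have pos: "0 < u x" if "x \<in> ball a r" for x
      using Re_w[of "f (of_real x)"] f(2) ball[OF that] v0 unfolding u_def by force
    have "(u has_real_derivative slope x (u x)) (at x)" if x: "x \<in> ball a r" for x
    proof -
      have "((\<lambda>t. f (of_real t)) has_vector_derivative G (of_real x) (f (of_real x))) (at x)"
        using f(3)[OF ball[OF x]] by (rule has_vector_derivative_real_field)
      then have "(u has_vector_derivative Re (G (of_real x) (f (of_real x)))) (at x)"
        unfolding u_def by (rule bounded_linear.has_vector_derivative[OF bounded_linear_Re])
      moreover have "0 < x" using Re_z[OF ball[OF x]] by simp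
      then have "G (of_real x) (f (of_real x)) = of_real (slope x (u x))"
        unfolding fu[OF x] G_def slope_def by (simp add: powr_of_real)
      ultimately show ?thesis by (simp add: has_real_derivative_iff_has_vector_derivative)
    qed
    moreover have "real_analytic_on u (ball a r)"
      unfolding real_analytic_on_def
    proof
      fix x assume x: "x \<in> ball a r"
      have "f holomorphic_on ball (of_real a) r"
        by (rule holomorphic_onI) (meson f(3) has_field_derivative_at_within field_differentiable_def)
      then have "f analytic_on {of_real x}"
        using ball[OF x] by (intro holomorphic_on_imp_analytic_at[of _ "ball (of_real a) r"]) auto
      then have "(\<lambda>h. f (of_real x + h)) has_fps_expansion fps_expansion f (of_real x)"
        by (rule analytic_at_imp_has_fps_expansion)
      from has_fps_expansion_Re[OF this]
      show "\<exists>F. (\<lambda>h. u (x + h)) has_fps_expansion F" unfolding u_def by auto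
    qed
    moreover have "u a = v" using f(1) by (simp add: u_def)
    ultimately show ?thesis using pos by blast
  qed
  then show ?thesis using that r e by force
qed

text \<open>\<open>sol_ge_floor\<close> preserves the lower bound \<open>m\<close>, so
  \<open>local_solution\<close> supplies one radius for all continuation steps and finitely many of
  them reach \<open>B\<close>.\<close>

lemma global_solution:
  assumes e: "0 < e" "e \<le> B" and v: "0 < v"
  obtains u where "u e = v" "sol e B u"
proof -
  \<comment> \<open>Chosen so that the initial value is above the floor and
    \<open>c * m \<le> e powr \<alpha>\<close>; the denominator \<open>c + 1\<close> is positive
    also for \<open>c = 0\<close>.\<close>
  define m where "m = min v (e powr \<alpha> / (c + 1))"
  have m: "0 < m" "m \<le> v" using v e c by (auto simp: m_def)
  have "m \<le> e powr \<alpha> / (c + 1)" by (simp add: m_def)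
  then have "m * (c + 1) \<le> e powr \<alpha>" using c by (simp add: pos_le_divide_eq)
  then have cm: "c * m \<le> e powr \<alpha>" using m by (simp add: algebra_simps)
  obtain r where r: "0 < r" "r < e" and
    loc: "\<And>a v. e \<le> a \<Longrightarrow> a \<le> B \<Longrightarrow> m \<le> v \<Longrightarrow> \<exists>u. u a = v \<and> real_analytic_on u (ball a r) \<and>
       (\<forall>x\<in>ball a r. 0 < u x \<and> (u has_real_derivative slope x (u x)) (at x))"
    using local_solution[OF e m(1)] by metis
  \<comment> \<open>Each step advances by \<open>r / 2\<close>, so the closed interval added lies
    inside the open ball of radius \<open>r\<close>.\<close>
  have ex: "\<exists>u. u e = v \<and> sol e (min B (e + real j * (r / 2))) u" for j
  proof (induction j)
    case 0
    obtain u where "u e = v" "\<forall>x\<in>ball e r. 0 < u x \<and> (u has_real_derivative slope x (u x)) (at x)"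
      using loc[of e v] e m by auto
    then show ?case using r e v
      by (intro exI[of _ u]) (auto simp: sol_def intro: has_field_derivative_at_within)
  next
    case (Suc j)
    let ?b = "min B (e + real j * (r / 2))" and ?b' = "min B (e + real (Suc j) * (r / 2))"
    obtain u where u: "u e = v" "sol e ?b u" using Suc by blast
    have b: "e \<le> ?b" "?b \<le> B" "?b \<le> ?b'" using e r by (auto simp: min_def field_simps)
    have b': "?b' \<le> ?b + r / 2" using r by (auto simp: min_def field_simps)
    have "m \<le> u ?b" using sol_ge_floor[OF u(2) e(1) _ b(1), of m] u(1) m cm by simp
    then obtain w where w: "w ?b = u ?b"
      "\<forall>x\<in>ball ?b r. 0 < w x \<and> (w has_real_derivative slope x (w x)) (at x)"
      using loc[OF b(1,2)] by blast
    have "sol ?b ?b' w"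
      unfolding sol_def
    proof
      fix x assume "x \<in> {?b..?b'}"
      then have "?b \<le> x" "x \<le> ?b + r / 2" using b' unfolding atLeastAtMost_iff by linarith+
      then have "x \<in> ball ?b r" using r unfolding mem_ball dist_real_def by linarith
      then show "0 < w x \<and> (w has_real_derivative slope x (w x)) (at x within {?b..?b'})"
        using w(2) has_field_derivative_at_within by blast
    qed
    from sol_glue[OF u(2) this w(1)[symmetric] b(1,3)] show ?case
      using u(1) b(1) by (intro exI[of _ "\<lambda>x. if x \<in> {e..?b} then u x else w x"]) auto
  qed
  obtain j :: nat where "(B - e) / (r / 2) \<le> real j" using real_arch_simple by blast
  then have "B \<le> e + real j * (r / 2)" using r by (simp add: field_simps)
  then show ?thesis using ex[of j] that by (auto simp: min_absorb1)
qed

section \<open>The curve \<open>y0\<close> as an upper barrier, and the limit of the solutions below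
  it\<close>

lemma y0_neg: "0 < x \<Longrightarrow> y0 \<Lambda> \<alpha> x < 0"
  using \<Lambda> \<alpha> by (simp add: y0_def)

text \<open>This is the orbit equation for \<open>c = 0\<close>. Inserting
  \<open>K * x powr ((1 + \<alpha>) / 2)\<close> forces
  \<open>K * K * (1 + \<alpha>) / 2 = 1 / \<Lambda>\<close>, the origin of the constant in
  \<open>y0\<close>.\<close>

lemma y0_deriv:
  assumes x: "0 < x"
  shows "((\<lambda>x. - y0 \<Lambda> \<alpha> x) has_real_derivative x powr \<alpha> / (\<Lambda> * - y0 \<Lambda> \<alpha> x)) (at x)"
proof -
  define K where "K = sqrt (2 / (\<Lambda> * (1 + \<alpha>)))"
  have K: "0 < K" "K * K = 2 / (\<Lambda> * (1 + \<alpha>))" using \<Lambda> \<alpha> by (auto simp: K_def)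
  have y0: "- y0 \<Lambda> \<alpha> x = K * x powr ((1 + \<alpha>) / 2)" for x by (simp add: y0_def K_def)
  have "((\<lambda>x. K * x powr ((1 + \<alpha>) / 2)) has_real_derivative
      K * ((1 + \<alpha>) / 2 * x powr ((1 + \<alpha>) / 2 - 1))) (at x)"
    using x by (auto intro!: derivative_eq_intros)
  moreover have "K * ((1 + \<alpha>) / 2 * x powr ((1 + \<alpha>) / 2 - 1))
      = x powr \<alpha> / (\<Lambda> * (K * x powr ((1 + \<alpha>) / 2)))"
  proof -
    have "(1 + \<alpha>) / 2 - 1 + (1 + \<alpha>) / 2 = \<alpha>" by (simp add: field_simps)
    then have "x powr ((1 + \<alpha>) / 2 - 1) * x powr ((1 + \<alpha>) / 2) = x powr \<alpha>"
      by (metis powr_add)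
    then have "(K * ((1 + \<alpha>) / 2 * x powr ((1 + \<alpha>) / 2 - 1))) * (\<Lambda> * (K * x powr ((1 + \<alpha>) / 2)))
        = (K * K) * (\<Lambda> * (1 + \<alpha>) / 2) * x powr \<alpha>" by (simp add: algebra_simps)
    also have "\<dots> = x powr \<alpha>" unfolding K(2) using \<Lambda> \<alpha> by simp
    finally show ?thesis using K \<Lambda> x by (simp add: eq_divide_eq)
  qed
  ultimately show ?thesis unfolding y0 by simp
qed

text \<open>Where \<open>u\<close> exceeds \<open>- y0\<close>, both the larger denominator and the
  term \<open>- c / \<Lambda>\<close> make its slope at most that of \<open>- y0\<close>.\<close>

lemma sol_le_y0:
  assumes u: "sol a b u" and ab: "0 < a" "a \<le> b" and le: "u a \<le> - y0 \<Lambda> \<alpha> a"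
  shows "u b \<le> - y0 \<Lambda> \<alpha> b"
proof -
  let ?U = "\<lambda>x. - y0 \<Lambda> \<alpha> x"
  have "0 \<le> ?U b - u b"
  proof (rule nonneg_if_nondecreasing_below_0[OF ab(2)])
    have "continuous_on {a..b} ?U"
      using ab by (intro DERIV_continuous_on[OF has_field_derivative_at_within[OF y0_deriv]]) auto
    then show "continuous_on {a..b} (\<lambda>x. ?U x - u x)"
      using sol_continuous[OF u] by (intro continuous_on_diff)
    fix x assume x: "a < x" "x < b" and neg: "?U x - u x < 0"
    have D: "((\<lambda>x. ?U x - u x) has_real_derivative x powr \<alpha> / (\<Lambda> * ?U x) - slope x (u x)) (at x)"
      using sol_deriv[OF u x] y0_deriv[of x] ab x by (intro DERIV_diff) auto
    have "x powr \<alpha> / (\<Lambda> * u x) \<le> x powr \<alpha> / (\<Lambda> * ?U x)"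
      using neg x ab sol_pos[OF u, of x] y0_neg[of x] \<Lambda>
      by (intro divide_left_mono mult_left_mono mult_pos_pos) auto
    moreover have "0 \<le> c / \<Lambda>" using c \<Lambda> by simp
    ultimately have "0 \<le> x powr \<alpha> / (\<Lambda> * ?U x) - slope x (u x)"
      unfolding slope_def by linarith
    then show "\<exists>D\<ge>0. ((\<lambda>x. ?U x - u x) has_real_derivative D) (at x)" using D by blast
  qed (use le in simp)
  then show ?thesis by simp
qed

text \<open>The intervals exhaust the positive half-line. Outside its own interval
  \<open>W n\<close> is arbitrary, so at a given \<open>x\<close> monotonicity and convergence
  concern only large \<open>n\<close>.\<close>

lemma monotone_approximation:
  obtains W :: "nat \<Rightarrow> real \<Rightarrow> real" and u :: "real \<Rightarrow> real" where
    "\<And>n. sol (1 / Suc n) (Suc n) (W n)"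
    "\<And>n x. x \<in> {1 / Suc n..Suc n} \<Longrightarrow> W n x \<le> - y0 \<Lambda> \<alpha> x"
    "\<And>n x. x \<in> {1 / Suc n..Suc n} \<Longrightarrow> u x \<le> W n x"
    "\<And>x. 0 < x \<Longrightarrow> (\<lambda>n. W n x) \<longlonglongrightarrow> u x"
proof -
  let ?e = "\<lambda>n::nat. 1 / real (Suc n)" and ?U = "\<lambda>x. - y0 \<Lambda> \<alpha> x"
  have "\<exists>w. w (?e n) = ?U (?e n) \<and> sol (?e n) (Suc n) w" for n
  proof (rule global_solution)
    show "0 < ?e n" "0 < ?U (?e n)" using y0_neg[of "?e n"] by auto
    show "?e n \<le> real (Suc n)" by (simp add: field_simps)
  qed blast
  then obtain W where W0: "\<And>n. W n (?e n) = ?U (?e n)" and W: "\<And>n. sol (?e n) (Suc n) (W n)"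
    by metis
  have WU: "W n x \<le> ?U x" if "x \<in> {?e n..Suc n}" for n x
    by (rule sol_le_y0[of "?e n" x "W n"]) (use that sol_subset[OF W[of n]] in \<open>auto simp: W0 simp del: of_nat_Suc\<close>)
  \<comment> \<open>At the point where \<open>W n\<close> starts on the barrier, the earlier started
    \<open>W m\<close> is already on or below it; \<open>sol_mono\<close> propagates this to the
    right.\<close>
  have anti: "W m x \<le> W n x" if nm: "n \<le> m" and x: "x \<in> {?e n..Suc n}" for n m x
  proof -
    have em: "?e m \<le> ?e n" using nm by (simp add: frac_le)
    have en: "?e n \<in> {?e m..Suc m}" using em nm by (auto simp: field_simps)
    have "W m (?e n) \<le> W n (?e n)" using WU[OF en] W0 by simp
    then show ?thesis using x nm em
      by (intro sol_mono[of "?e n" x "W m" "W n"] sol_subset[OF W]) auto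
  qed
  have ev: "\<exists>N. \<forall>n\<ge>N. x \<in> {?e n..Suc n}" if "0 < x" for x :: real
  proof -
    obtain N :: nat where N: "max x (1 / x) \<le> real N" using real_arch_simple by blast
    have "x \<in> {?e n..Suc n}" if "n \<ge> N" for n
    proof -
      have "1 / x \<le> Suc n" "x \<le> Suc n" using N that by auto
      then show ?thesis using \<open>0 < x\<close> by (auto simp: field_simps)
    qed
    then show ?thesis by blast
  qed
  have "convergent (\<lambda>n. W n x)" if x: "0 < x" for x
  proof -
    obtain N where N: "\<And>n. n \<ge> N \<Longrightarrow> x \<in> {?e n..Suc n}" using ev[OF x] by blast
    have "decseq (\<lambda>n. W (n + N) x)" by (intro decseq_SucI anti N) auto
    moreover have "0 \<le> W (n + N) x" for n
      using sol_pos[OF W N[of "n + N"]] by simp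
    ultimately obtain L where "(\<lambda>n. W (n + N) x) \<longlonglongrightarrow> L" using decseq_convergent by metis
    then have "(\<lambda>n. W n x) \<longlonglongrightarrow> L" by (rule LIMSEQ_offset)
    then show ?thesis by (rule convergentI)
  qed
  then have lim: "(\<lambda>n. W n x) \<longlonglongrightarrow> lim (\<lambda>n. W n x)" if "0 < x" for x
    using that convergent_LIMSEQ_iff by blast
  have "lim (\<lambda>n. W n x) \<le> W n x" if x: "x \<in> {?e n..Suc n}" for n x
  proof (rule LIMSEQ_le_const2)
    have "0 < ?e n" by simp
    moreover have "?e n \<le> x" using x by simp
    ultimately have "0 < x" by (rule less_le_trans)
    then show "(\<lambda>n. W n x) \<longlonglongrightarrow> lim (\<lambda>n. W n x)" by (rule lim)
    show "\<exists>N. \<forall>m\<ge>N. W m x \<le> W n x" using anti x by blast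
  qed
  then show ?thesis
    by (intro that[of W "\<lambda>x. lim (\<lambda>n. W n x)"] W WU lim)
qed

text \<open>A pointwise limit need not be a solution. The barrier of \<open>sol_ge_linear\<close>
  gives positivity and thus a uniform local radius; comparison with a local analytic solution then
  gives the equation and analyticity together.\<close>

lemma stable_solution:
  obtains u where "\<And>x. 0 < x \<Longrightarrow> 0 < u x" "\<And>x. 0 < x \<Longrightarrow> u x \<le> - y0 \<Lambda> \<alpha> x"
    "\<And>x. 0 < x \<Longrightarrow> (u has_real_derivative slope x (u x)) (at x)"
    "real_analytic_on u {0<..}"
proof -
  obtain W u where W: "\<And>n. sol (1 / Suc n) (Suc n) (W n)"
    and WU: "\<And>n x. x \<in> {1 / Suc n..Suc n} \<Longrightarrow> W n x \<le> - y0 \<Lambda> \<alpha> x"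
    and uW: "\<And>n x. x \<in> {1 / Suc n..Suc n} \<Longrightarrow> u x \<le> W n x"
    and lim: "\<And>x. 0 < x \<Longrightarrow> (\<lambda>n. W n x) \<longlonglongrightarrow> u x"
    using monotone_approximation by metis
  have sol_ev: "\<exists>N. \<forall>n\<ge>N. 1 / Suc n \<le> a \<and> b \<le> Suc n \<and> sol a b (W n)"
    if "0 < a" for a b :: real
  proof -
    obtain N :: nat where N: "max b (1 / a) \<le> real N" using real_arch_simple by blast
    have "1 / Suc n \<le> a \<and> b \<le> Suc n" if "n \<ge> N" for n
    proof -
      have "1 / a \<le> Suc n" "b \<le> Suc n" using N that by auto
      then show ?thesis using \<open>0 < a\<close> by (auto simp: field_simps)
    qed
    then show ?thesis using sol_subset[OF W] by blast
  qed
  have lower: "\<exists>\<delta>>0. \<forall>s\<in>{a..b}. \<delta> * (s - a) \<le> u s" if ab: "0 < a" "a < b" for a b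
  proof -
    obtain \<delta> where \<delta>: "0 < \<delta>" "\<And>u s. a \<le> s \<Longrightarrow> s \<le> b \<Longrightarrow> sol a s u \<Longrightarrow> \<delta> * (s - a) \<le> u s"
      using sol_ge_linear[OF ab] by metis
    have "\<delta> * (s - a) \<le> u s" if s: "s \<in> {a..b}" for s
    proof (rule LIMSEQ_le_const)
      show "(\<lambda>n. W n s) \<longlonglongrightarrow> u s" using lim s ab by simp
      show "\<exists>N. \<forall>n\<ge>N. \<delta> * (s - a) \<le> W n s" using sol_ev[OF ab(1), of s] \<delta>(2) s by auto
    qed
    then show ?thesis using \<delta>(1) by blast
  qed
  have upos: "0 < u x" if x: "0 < x" for x
  proof -
    obtain \<delta> where \<delta>: "0 < \<delta>" "\<forall>s\<in>{x/2..x}. \<delta> * (s - x/2) \<le> u s" using lower[of "x/2" x] x by auto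
    have "\<delta> * (x - x/2) \<le> u x" using bspec[OF \<delta>(2), of x] x by simp
    moreover have "0 < \<delta> * (x - x/2)" using x \<delta> by simp
    ultimately show ?thesis by linarith
  qed
  have uU: "u x \<le> - y0 \<Lambda> \<alpha> x" if x: "0 < x" for x
  proof -
    obtain N where "1 / Suc N \<le> x \<and> x \<le> Suc N" using sol_ev[OF x, of x] by blast
    then show ?thesis using uW[of x N] WU[of x N] by simp
  qed
  have local: "\<exists>f S. open S \<and> x \<in> S \<and> (\<forall>t\<in>S. u t = f t) \<and> real_analytic_on f S \<and>
      (\<forall>t\<in>S. (f has_real_derivative slope t (f t)) (at t))" if x: "0 < x" for x
  proof -
    \<comment> \<open>The linear bound vanishes at its left end; starting it at \<open>x/4\<close>
      leaves the fixed floor \<open>\<delta> * (x/4)\<close> on the half interval from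
      \<open>x/2\<close> to \<open>x\<close>.\<close>
    obtain \<delta> where \<delta>: "0 < \<delta>" "\<And>s. s \<in> {x/4..x} \<Longrightarrow> \<delta> * (s - x/4) \<le> u s"
      using lower[of "x/4" x] x by auto
    have floor: "\<delta> * (x/4) \<le> u s" if "s \<in> {x/2..x}" for s
    proof -
      have "\<delta> * (x/4) \<le> \<delta> * (s - x/4)" using \<delta>(1) that by (intro mult_left_mono) auto
      also have "\<dots> \<le> u s" using that x by (intro \<delta>(2)) auto
      finally show ?thesis .
    qed
    have "0 < x/2" "x/2 \<le> x" "0 < \<delta> * (x/4)" using x \<delta> by auto
    then obtain r where r: "0 < r" "r < x/2" and
      loc: "\<And>a v. x/2 \<le> a \<Longrightarrow> a \<le> x \<Longrightarrow> \<delta> * (x/4) \<le> v \<Longrightarrow>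
        \<exists>f. f a = v \<and> real_analytic_on f (ball a r) \<and>
       (\<forall>t\<in>ball a r. 0 < f t \<and> (f has_real_derivative slope t (f t)) (at t))"
      using local_solution by metis
    \<comment> \<open>Contraction works only to the right, so the base point lies left of
      \<open>x\<close>; this choice makes \<open>x\<close> the midpoint of
      \<open>?S\<close>.\<close>
    define a where "a = x - r/2"
    have a: "x/2 \<le> a" "a \<le> x" "0 < a" using r x by (auto simp: a_def)
    obtain f where f: "f a = u a" "real_analytic_on f (ball a r)"
      "\<And>t. t \<in> ball a r \<Longrightarrow> 0 < f t"
      "\<And>t. t \<in> ball a r \<Longrightarrow> (f has_real_derivative slope t (f t)) (at t)"
      using loc[of a "u a"] floor[of a] a by auto
    \<comment> \<open>by contraction from \<open>a\<close>, \<open>W n - f\<close> is bounded by \<open>W n a - u a\<close>, which tends to \<open>0\<close>\<close>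
    let ?S = "{a<..<a + r}"
    have S: "?S \<subseteq> ball a r" by (auto simp: dist_real_def)
    have "u t = f t" if t: "t \<in> ?S" for t
    proof -
      have solf: "sol a t f"
        unfolding sol_def using t f(3,4) by (auto simp: dist_real_def intro: has_field_derivative_at_within)
      obtain N where N: "\<And>n. n \<ge> N \<Longrightarrow> 1 / Suc n \<le> a \<and> t \<le> Suc n \<and> sol a t (W n)"
        using sol_ev[OF a(3), of t] by blast
      have "0 \<le> W n t - f t \<and> W n t - f t \<le> W n a - u a" if n: "n \<ge> N" for n
      proof -
        have "f a \<le> W n a" unfolding f(1) using N[OF n] t by (intro uW) auto
        then show ?thesis
          using sol_mono[OF solf, of "W n"] sol_contraction[OF solf, of "W n"] N[OF n] t f(1) by simp
      qed
      then have "\<forall>\<^sub>F n in sequentially. norm (W n t - f t) \<le> W n a - u a"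
        unfolding eventually_sequentially by (intro exI[of _ N]) auto
      moreover have "(\<lambda>n. W n a - u a) \<longlonglongrightarrow> 0" using lim[OF a(3)] by (rule LIM_zero)
      ultimately have "(\<lambda>n. W n t - f t) \<longlonglongrightarrow> 0" by (rule Lim_null_comparison)
      then have "(\<lambda>n. W n t) \<longlonglongrightarrow> f t" by (rule LIM_zero_cancel)
      then show ?thesis using lim[of t] t a LIMSEQ_unique by auto
    qed
    moreover have "x \<in> ?S" using r by (auto simp: a_def)
    moreover have "real_analytic_on f ?S" using f(2) S unfolding real_analytic_on_def by blast
    ultimately show ?thesis using f(4) S by (intro exI[of _ f] exI[of _ ?S]) auto
  qed
  have "(u has_real_derivative slope x (u x)) (at x)" if x: "0 < x" for x
  proof -
    obtain f S where *: "open S" "x \<in> S" "\<forall>t\<in>S. u t = f t"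
      "\<forall>t\<in>S. (f has_real_derivative slope t (f t)) (at t)" using local[OF x] by blast
    then have "(f has_real_derivative slope x (u x)) (at x)" by simp
    then show ?thesis
      by (rule has_field_derivative_transform_within_open) (use * in auto)
  qed
  moreover have "real_analytic_on u {0<..}"
    unfolding real_analytic_on_def
  proof
    fix x :: real assume "x \<in> {0<..}"
    then obtain f S where *: "open S" "x \<in> S" "\<forall>t\<in>S. u t = f t" "real_analytic_on f S"
      using local[of x] by auto
    then show "\<exists>F. (\<lambda>h. u (x + h)) has_fps_expansion F"
      using real_analytic_on_cong[of S u f] unfolding real_analytic_on_def by blast
  qed
  ultimately show ?thesis using that upos uU by blast
qed

end

section \<open>Trajectories converging to the origin\<close>

lemma is_interval_Icc_subset:
  fixes J :: "real set"
  assumes "is_interval J" "a \<in> J" "b \<in> J"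
  shows "{a..b} \<subseteq> J"
proof
  fix x assume "x \<in> {a..b}"
  then show "x \<in> J" using mem_is_interval_1_I[OF assms] by simp
qed

lemma SUP_ereal_less_no_max:
  fixes J :: "real set"
  assumes "\<And>t. t \<in> J \<Longrightarrow> \<exists>s\<in>J. t < s" "t \<in> J"
  shows "ereal t < (SUP s\<in>J. ereal s)"
proof -
  obtain s where "s \<in> J" "t < s" using assms by blast
  then show ?thesis by (auto simp: less_SUP_iff)
qed

lemma converges_to_origin_meets_nbhd:
  assumes conv: "converges_to_origin J \<delta>" and J: "\<And>t. t \<in> J \<Longrightarrow> \<exists>s\<in>J. t < s" "t0 \<in> J"
    and S: "open S" "(0, 0) \<in> S"
  obtains s where "s \<in> J" "t0 < s" "\<delta> s \<in> S"
proof -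
  let ?T = "SUP t\<in>J. ereal t"
  have t0: "ereal t0 < ?T" using SUP_ereal_less_no_max[OF J] .
  have "\<forall>\<^sub>F t in at_left ?T. \<delta> (real_of_ereal t) \<in> S"
    using conv S unfolding converges_to_origin_def by (rule topological_tendstoD)
  then obtain b where b: "b < ?T" "\<And>t. b < t \<Longrightarrow> t < ?T \<Longrightarrow> \<delta> (real_of_ereal t) \<in> S"
    unfolding eventually_at_left[OF t0] by blast
  have "max b (ereal t0) < ?T" using b t0 by simp
  then obtain s where s: "s \<in> J" "max b (ereal t0) < ereal s" by (auto simp: less_SUP_iff)
  then have "\<delta> s \<in> S" using b(2)[of "ereal s"] SUP_ereal_less_no_max[OF J(1) s(1)] by simp
  then show ?thesis using that s by simp
qed

text \<open>At a largest time, continuity from the left would give the value \<open>(0, 0)\<close>,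
  which solutions avoid. Nondegeneracy of \<open>J\<close> provides earlier times.\<close>

lemma converges_to_origin_no_max:
  assumes conv: "converges_to_origin J \<delta>" and sol: "solution_on \<Lambda> \<alpha> c J \<delta>" and t: "t \<in> J"
  shows "\<exists>s\<in>J. t < s"
proof (rule ccontr)
  assume "\<not> ?thesis"
  then have max: "\<And>s. s \<in> J \<Longrightarrow> s \<le> t" by force
  have int: "is_interval J" and "interior J \<noteq> {}"
    and J: "\<And>t. t \<in> J \<Longrightarrow> \<delta> t \<noteq> (0, 0)"
      "\<And>t. t \<in> J \<Longrightarrow> (\<delta> has_vector_derivative X \<Lambda> \<alpha> c (\<delta> t)) (at t within J)"
    using sol unfolding solution_on_def by auto
  then obtain p e where "0 < e" "ball p e \<subseteq> J" by (meson all_not_in_conv mem_interior)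
  then have "p - e / 2 \<in> J" "p \<in> J" by (auto simp: dist_real_def subset_iff)
  then obtain t0 where t0: "t0 \<in> J" "t0 < t" using max[of p] \<open>0 < e\<close> by force
  have sub: "{t0..t} \<subseteq> J" using is_interval_Icc_subset[OF int t0(1) t] .
  have "continuous (at t within J) \<delta>"
    using J(2)[OF t] by (rule has_vector_derivative_continuous)
  then have "continuous (at t within {t0..t}) \<delta>" using sub by (rule continuous_within_subset)
  then have "(\<delta> \<longlongrightarrow> \<delta> t) (at_left t)"
    using t0 by (simp add: continuous_within at_within_Icc_at_left)
  moreover have "(SUP s\<in>J. ereal s) = ereal t"
    using t max by (intro antisym SUP_least SUP_upper) auto
  then have "(\<delta> \<longlongrightarrow> (0, 0)) (at_left t)"
    using conv ereal_tendsto_simps1(1)[of \<delta> "(0,0)" t]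
    unfolding converges_to_origin_def by (simp add: o_def)
  ultimately have "\<delta> t = (0, 0)" using tendsto_unique by (metis trivial_limit_at_left_real)
  then show False using J(1)[OF t] by simp
qed

section \<open>Solutions of the system in coordinates\<close>

context saddle
begin

lemma solution_on_coordinates:
  assumes "solution_on \<Lambda> \<alpha> c J \<delta>" "t \<in> J"
  shows "0 \<le> fst (\<delta> t)" "snd (\<delta> t) \<le> 0" "\<delta> t \<noteq> (0, 0)"
    "((\<lambda>t. fst (\<delta> t)) has_real_derivative snd (\<delta> t)) (at t within J)"
    "((\<lambda>t. snd (\<delta> t)) has_real_derivative
       (c * snd (\<delta> t) + fst (\<delta> t) powr \<alpha>) / \<Lambda>) (at t within J)"
proof -
  have Q: "\<delta> t \<in> Q - {(0, 0)}" and D: "(\<delta> has_vector_derivative X \<Lambda> \<alpha> c (\<delta> t)) (at t within J)"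
    using assms unfolding solution_on_def by auto
  show "0 \<le> fst (\<delta> t)" "snd (\<delta> t) \<le> 0" "\<delta> t \<noteq> (0, 0)" using Q by (auto simp: Q_def)
  have "((\<lambda>t. fst (\<delta> t)) has_vector_derivative fst (X \<Lambda> \<alpha> c (\<delta> t))) (at t within J)"
    "((\<lambda>t. snd (\<delta> t)) has_vector_derivative snd (X \<Lambda> \<alpha> c (\<delta> t))) (at t within J)"
    using bounded_linear.has_vector_derivative[OF bounded_linear_fst D]
      bounded_linear.has_vector_derivative[OF bounded_linear_snd D] by simp_all
  then show "((\<lambda>t. fst (\<delta> t)) has_real_derivative snd (\<delta> t)) (at t within J)"
    "((\<lambda>t. snd (\<delta> t)) has_real_derivative
       (c * snd (\<delta> t) + fst (\<delta> t) powr \<alpha>) / \<Lambda>) (at t within J)"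
    by (auto simp: X_def split_beta has_real_derivative_iff_has_vector_derivative)
qed

text \<open>On the boundary the field points out of \<open>Q\<close>: \<open>y' > 0\<close> where
  \<open>y = 0 < x\<close>, and \<open>x' < 0\<close> where \<open>x = 0 > y\<close>. The later time
  \<open>s\<close> guarantees that the exit would happen within \<open>J\<close>.\<close>

lemma solution_on_interior_quadrant:
  assumes sol: "solution_on \<Lambda> \<alpha> c J \<delta>" and s: "s \<in> J" "t < s" and t: "t \<in> J"
  shows "0 < fst (\<delta> t)" "snd (\<delta> t) < 0"
proof -
  have sub: "{t..s} \<subseteq> J"
    using sol s t unfolding solution_on_def by (simp add: is_interval_Icc_subset)
  note D = solution_on_coordinates[OF sol]
  show "snd (\<delta> t) < 0"
  proof (rule ccontr)
    assume "\<not> ?thesis"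
    then have snd0: "snd (\<delta> t) = 0" using D(2)[OF t] by simp
    then have "0 < fst (\<delta> t)" using D(1,3)[OF t] by (metis less_le prod.collapse)
    then have "0 < (c * snd (\<delta> t) + fst (\<delta> t) powr \<alpha>) / \<Lambda>" using snd0 \<Lambda> by simp
    from has_real_derivative_pos_inc_right[OF D(5)[OF t] this]
    obtain d where d: "d > 0" "\<And>h. h > 0 \<Longrightarrow> t + h \<in> J \<Longrightarrow> h < d \<Longrightarrow> snd (\<delta> t) < snd (\<delta> (t + h))"
      by blast
    define h where "h = min (d / 2) (s - t)"
    have h: "0 < h" "h < d" "t + h \<in> J" using d s sub by (auto simp: h_def)
    then show False using d(2)[of h] D(2)[of "t + h"] snd0 by auto
  qed
  show "0 < fst (\<delta> t)"
  proof (rule ccontr)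
    assume "\<not> ?thesis"
    then have fst0: "fst (\<delta> t) = 0" using D(1)[OF t] by simp
    from has_real_derivative_neg_dec_right[OF D(4)[OF t] \<open>snd (\<delta> t) < 0\<close>]
    obtain d where d: "d > 0" "\<And>h. h > 0 \<Longrightarrow> t + h \<in> J \<Longrightarrow> h < d \<Longrightarrow> fst (\<delta> (t + h)) < fst (\<delta> t)"
      by blast
    define h where "h = min (d / 2) (s - t)"
    have h: "0 < h" "h < d" "t + h \<in> J" using d s sub by (auto simp: h_def)
    then show False using d(2)[of h] D(1)[of "t + h"] fst0 by auto
  qed
qed

end

text \<open>Isolates what is needed of \<open>u\<close>, for use twice: with the limit solution for
  \<open>c\<close>, and with \<open>- y0\<close> for \<open>c = 0\<close>, which identifies
  \<open>L0\<close>.\<close>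

locale separatrix = saddle +
  fixes u :: "real \<Rightarrow> real"
  assumes pos: "0 < x \<Longrightarrow> 0 < u x"
    and deriv: "0 < x \<Longrightarrow> (u has_real_derivative slope x (u x)) (at x)"
    and lim0: "(u \<longlongrightarrow> 0) (at_right 0)"
begin

text \<open>Extension by 0 to the left makes two-sided continuity available at the origin, both for
  \<open>y 0 = 0\<close> and for the limit along converging solutions.\<close>

lemma isCont_extension:
  assumes "0 \<le> x"
  shows "isCont (\<lambda>x. if 0 < x then u x else 0) x"
proof (cases "x = 0")
  case True
  have "((\<lambda>x. if 0 < x then u x else 0) \<longlongrightarrow> 0) (at_right 0)"
    using lim0 by (rule Lim_transform_eventually)
      (auto intro: eventually_mono[OF eventually_at_right_less[of 0]])
  moreover have "((\<lambda>x. if 0 < x then u x else 0) \<longlongrightarrow> 0) (at_left 0)"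
    by (rule Lim_transform_eventually[OF tendsto_const])
      (auto simp: eventually_at_filter)
  ultimately show ?thesis using True by (simp add: isCont_def filterlim_split_at)
next
  case False
  then have x: "0 < x" using assms by simp
  then have "isCont u x" using deriv DERIV_isCont by blast
  moreover have "\<forall>\<^sub>F t in nhds x. (if 0 < t then u t else 0) = u t"
    using x by (auto intro: eventually_mono[OF eventually_nhds_in_open[of "{0<..}"]])
  ultimately show ?thesis by (simp add: isCont_cong)
qed

lemma converging_solution_on_graph:
  assumes sol: "solution_on \<Lambda> \<alpha> c J \<delta>" and conv: "converges_to_origin J \<delta>" and t0: "t0 \<in> J"
  shows "0 < fst (\<delta> t0)" "snd (\<delta> t0) = - u (fst (\<delta> t0))"
proof -
  note no_max = converges_to_origin_no_max[OF conv sol]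
  note D = solution_on_coordinates[OF sol]
  define xi where "xi t = fst (\<delta> t)" for t
  define eta where "eta t = snd (\<delta> t)" for t
  have xi: "0 < xi t" and eta: "eta t < 0" if "t \<in> J" for t
    using solution_on_interior_quadrant[OF sol] no_max[OF that] that
    unfolding xi_def eta_def by blast+
  show "0 < fst (\<delta> t0)" using xi[OF t0] by (simp add: xi_def)
  define w where "w t = ((eta t)\<^sup>2 - (u (xi t))\<^sup>2)\<^sup>2" for t
  have w_deriv: "\<exists>y\<ge>0. (w has_real_derivative y) (at t within J)" if t: "t \<in> J" for t
  proof -
    define A B where "A = (c * eta t + xi t powr \<alpha>) / \<Lambda>" and "B = slope (xi t) (u (xi t)) * eta t"
    have dx: "(xi has_real_derivative eta t) (at t within J)"
      and dy: "(eta has_real_derivative A) (at t within J)"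
      using D(4,5)[OF t] unfolding xi_def eta_def A_def by auto
    have du: "((\<lambda>t. u (xi t)) has_real_derivative B) (at t within J)"
      unfolding B_def by (rule DERIV_chain2[OF deriv dx]) (rule xi[OF t])
    have u0: "0 < u (xi t)" using pos xi[OF t] by blast
    let ?y = "2 * ((eta t)\<^sup>2 - (u (xi t))\<^sup>2) * (2 * eta t * A - 2 * u (xi t) * B)"
    have "(w has_real_derivative ?y) (at t within J)"
      unfolding w_def by (auto intro!: derivative_eq_intros dy du simp: algebra_simps power2_eq_square)
    \<comment> \<open>The \<open>\<alpha>\<close>-power terms cancel because \<open>u\<close> solves
      the orbit equation. Both \<open>eta t\<close> and \<open>eta t - u (xi t)\<close> are
      negative, and the other nonconstant factor is a square.\<close>
    moreover have "?y = 4 * (c / \<Lambda>) * (eta t * (eta t - u (xi t))) * (eta t + u (xi t))\<^sup>2"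
      using u0 \<Lambda> unfolding A_def B_def slope_def by (simp add: field_simps power2_eq_square)
    moreover have "0 \<le> \<dots>" using c \<Lambda> u0 eta[OF t]
      by (intro mult_nonneg_nonneg mult_nonpos_nonpos) auto
    ultimately show ?thesis by auto
  qed
  have mono: "w t \<le> w s" if ts: "t \<in> J" "s \<in> J" "t \<le> s" for t s
  proof (rule DERIV_nonneg_imp_increasing_open[OF ts(3), of w])
    have sub: "{t..s} \<subseteq> J"
      using sol ts unfolding solution_on_def by (simp add: is_interval_Icc_subset)
    have "continuous_on J w"
      using w_deriv DERIV_continuous by (force simp: continuous_on_eq_continuous_within)
    then show "continuous_on {t..s} w" using sub continuous_on_subset by blast
    fix p assume p: "t < p" "p < s"
    have "at p within J = at p"
      by (rule at_within_open_subset[of p "{t<..<s}"]) (use p sub in auto)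
    moreover have "p \<in> J" using p sub by auto
    ultimately show "\<exists>y. DERIV w p :> y \<and> y \<ge> 0" using w_deriv[of p] by auto
  qed
  have "w t0 = 0"
  proof (rule ccontr)
    assume "w t0 \<noteq> 0"
    then have w0: "0 < w t0" by (simp add: w_def)
    \<comment> \<open>\<open>w\<close> is \<open>?F\<close> composed with \<open>\<delta>\<close>,
      and \<open>?F\<close> is continuous at the origin with value 0. So \<open>w\<close> falls
      below \<open>w t0\<close> at some later time, against monotonicity.\<close>
    let ?F = "\<lambda>p. ((snd p)\<^sup>2 - (if 0 < fst p then u (fst p) else 0)\<^sup>2)\<^sup>2"
    have "isCont (\<lambda>p::real \<times> real. if 0 < fst p then u (fst p) else 0) (0, 0)"
      by (rule isCont_o2[of "(0, 0)" fst]) (use isCont_extension[of 0] in auto)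
    then have "isCont ?F (0, 0)" by (intro continuous_intros)
    then have "(?F \<longlongrightarrow> ?F (0, 0)) (nhds (0, 0))"
      using tendsto_at_iff_tendsto_nhds[of ?F "(0, 0)"] unfolding isCont_def by blast
    then have "\<forall>\<^sub>F p in nhds (0, 0). ?F p < w t0" by (rule order_tendstoD) (use w0 in simp)
    then obtain S where S: "open S" "(0, 0) \<in> S" "\<And>p. p \<in> S \<Longrightarrow> ?F p < w t0"
      unfolding eventually_nhds by blast
    obtain s where s: "s \<in> J" "t0 < s" "\<delta> s \<in> S"
      using converges_to_origin_meets_nbhd[OF conv no_max t0 S(1,2)] .
    then have "w s < w t0" using S(3)[of "\<delta> s"] xi[of s] by (simp add: w_def xi_def eta_def)
    then show False using mono[of t0 s] s t0 by simp
  qed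
  then have "(eta t0)\<^sup>2 = (u (xi t0))\<^sup>2" by (simp add: w_def)
  then have "eta t0 = - u (xi t0)"
    using eta[OF t0] pos[OF xi[OF t0]] by (auto simp: power2_eq_iff)
  then show "snd (\<delta> t0) = - u (fst (\<delta> t0))" by (simp add: xi_def eta_def)
qed

text \<open>Motion is to the left, so \<open>T\<close> is decreasing and its inverse is the first
  coordinate. Whether the origin is approached in finite or infinite time is left open; the extended
  supremum covers both.\<close>

lemma trajectory_along_graph:
  obtains I \<gamma> where "trajectory \<Lambda> \<alpha> c I \<gamma>" "converges_to_origin I \<gamma>"
    "\<gamma> ` I = graph_pos (\<lambda>x. - u x)"
proof -
  \<comment> \<open>\<open>T\<close> is time as a function of \<open>x\<close>, from \<open>dt = dx / y\<close>\<close>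
  have "isCont (\<lambda>x. - 1 / u x) x" if "0 < x" for x
    using that pos[OF that] DERIV_isCont[OF deriv[OF that]] by (intro continuous_intros) auto
  then obtain T where T': "\<And>x. 0 < x \<Longrightarrow> (T has_vector_derivative - 1 / u x) (at x)"
    using einterval_antiderivative[of 0 \<infinity> "\<lambda>x. - 1 / u x"] by (auto simp: zero_ereal_def)
  then have T: "(T has_real_derivative - 1 / u x) (at x)" if "0 < x" for x
    using that by (simp add: has_real_derivative_iff_has_vector_derivative)
  have T_dec: "T y < T x" if "0 < x" "x < y" for x y
  proof (rule DERIV_neg_imp_decreasing[OF that(2)])
    fix z assume "x \<le> z" "z \<le> y"
    then have "0 < z" using that by simp
    then show "\<exists>y. DERIV T z :> y \<and> y < 0" using T[of z] pos[of z] by (intro exI conjI) auto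
  qed
  then have T_le: "T y \<le> T x" if "0 < x" "x \<le> y" for x y
    using that by (auto simp: le_less)
  have inj: "inj_on T {0<..}"
  proof (rule inj_onI)
    fix x y assume "x \<in> {0<..}" "y \<in> {0<..}" "T x = T y"
    then show "x = y"
      using T_dec[of x y] T_dec[of y x] linorder_less_linear[of x y] by auto
  qed
  have cont: "continuous_on {0<..} T"
  proof (rule DERIV_continuous_on)
    fix x :: real assume "x \<in> {0<..}"
    then show "(T has_real_derivative - 1 / u x) (at x within {0<..})"
      using has_field_derivative_at_within[OF T[of x]] by simp
  qed
  define I where "I = T ` {0<..}"
  define \<xi> where "\<xi> = inv_into {0<..} T"
  define \<gamma> where "\<gamma> t = (\<xi> t, - u (\<xi> t))" for t
  have \<xi>T: "\<xi> (T x) = x" if "0 < x" for x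
    using inv_into_f_f[OF inj] that by (simp add: \<xi>_def)
  then have \<gamma>T: "\<gamma> (T x) = (x, - u x)" if "0 < x" for x
    using that by (simp add: \<gamma>_def)
  have TI: "T x \<in> I" if "0 < x" for x using that by (simp add: I_def)
  have intI: "is_interval I"
    unfolding I_def is_interval_connected_1
    by (intro connected_continuous_image cont connected_Ioi)
  \<comment> \<open>Openness supplies the nonempty interior that \<open>solution_on\<close>
    demands.\<close>
  have openI: "open I" unfolding I_def by (intro invariance_of_domain cont inj) auto
  have lim: "((\<lambda>x. (x, - u x)) \<longlongrightarrow> (0, 0)) (at_right 0)"
    using tendsto_Pair[OF tendsto_ident_at tendsto_minus[OF lim0]] by simp
  have near0: "\<exists>b>0. \<forall>x. 0 < x \<longrightarrow> x < b \<longrightarrow> (x, - u x) \<in> S" if "open S" "(0, 0) \<in> S" for S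
    using topological_tendstoD[OF lim that] by (auto simp: eventually_at_right[of 0 1])
  have sol: "solution_on \<Lambda> \<alpha> c I \<gamma>"
    unfolding solution_on_def
  proof (intro conjI ballI)
    show "is_interval I" by (rule intI)
    show "interior I \<noteq> {}" using openI TI[of 1] by (auto simp: interior_open)
    fix t assume "t \<in> I"
    then obtain x where x: "0 < x" "t = T x" by (auto simp: I_def)
    show "\<gamma> t \<in> Q - {(0, 0)}" using x pos[OF x(1)] by (simp add: \<gamma>T Q_def)
    have "(\<xi> has_real_derivative inverse (- 1 / u x)) (at t)"
      unfolding x(2)
      by (rule has_field_derivative_inverse_strong[OF T[OF x(1)], of "{0<..}"])
        (use x pos[OF x(1)] cont \<xi>T in auto)
    then have \<xi>': "(\<xi> has_real_derivative - u x) (at t)" by simp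
    moreover have "((\<lambda>t. - u (\<xi> t)) has_real_derivative - (slope x (u x) * - u x)) (at t)"
      using x \<xi>T deriv \<xi>' by (intro DERIV_minus DERIV_chain2[of u]) auto
    moreover have "- (slope x (u x) * - u x) = (1 / \<Lambda>) * (c * - u x + x powr \<alpha>)"
      using pos[OF x(1)] \<Lambda> by (simp add: slope_def field_simps)
    ultimately have "(\<gamma> has_vector_derivative (- u x, (1 / \<Lambda>) * (c * - u x + x powr \<alpha>))) (at t)"
      unfolding \<gamma>_def has_real_derivative_iff_has_vector_derivative
      by (intro has_vector_derivative_Pair) simp_all
    then have "(\<gamma> has_vector_derivative X \<Lambda> \<alpha> c (\<gamma> t)) (at t)"
      unfolding x(2) \<gamma>T[OF x(1)] X_def by simp
    then show "(\<gamma> has_vector_derivative X \<Lambda> \<alpha> c (\<gamma> t)) (at t within I)"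
      by (rule has_vector_derivative_at_within)
  qed
  have conv: "converges_to_origin I \<gamma>"
    unfolding converges_to_origin_def
  proof (rule topological_tendstoI)
    fix S :: "(real \<times> real) set" assume "open S" "(0, 0) \<in> S"
    then obtain b where b: "b > 0" "\<And>x. 0 < x \<Longrightarrow> x < b \<Longrightarrow> (x, - u x) \<in> S" using near0 by blast
    let ?T = "SUP t\<in>I. ereal t"
    have "\<exists>s\<in>I. t < s" if "t \<in> I" for t
    proof -
      obtain x where x: "0 < x" "t = T x" using \<open>t \<in> I\<close> by (auto simp: I_def)
      then show ?thesis using TI[of "x/2"] T_dec[of "x/2" x] by auto
    qed
    then have T: "ereal (T b) < ?T" using TI[OF b(1)] by (rule SUP_ereal_less_no_max)
    have "\<gamma> (real_of_ereal t) \<in> S" if t: "ereal (T b) < t" "t < ?T" for t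
    proof -
      obtain s where s: "s \<in> I" "t < ereal s" using t(2) by (auto simp: less_SUP_iff)
      then obtain r where r: "t = ereal r" using t(1) by (cases t) auto
      then have "r \<in> I"
        using is_interval_Icc_subset[OF intI TI[OF b(1)] s(1)] s(2) t(1) by auto
      then obtain x where x: "0 < x" "r = T x" by (auto simp: I_def)
      then have "x < b" using T_le[of b x] b(1) t(1) r by force
      then show ?thesis using x b(2) r by (simp add: \<gamma>T)
    qed
    then show "\<forall>\<^sub>F t in at_left ?T. \<gamma> (real_of_ereal t) \<in> S"
      using T by (auto simp: eventually_at_left[OF T])
  qed
  have "trajectory \<Lambda> \<alpha> c I \<gamma>"
    unfolding trajectory_def
  proof (intro conjI allI impI sol)
    fix J \<delta> assume *: "solution_on \<Lambda> \<alpha> c J \<delta> \<and> I \<subseteq> J \<and> (\<forall>t\<in>I. \<delta> t = \<gamma> t)"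
    then have IJ: "I \<subseteq> J" and eq: "\<And>t. t \<in> I \<Longrightarrow> \<delta> t = \<gamma> t" and intJ: "is_interval J"
      and J0: "\<And>t. t \<in> J \<Longrightarrow> \<delta> t \<noteq> (0, 0)" by (auto simp: solution_on_def)
    have "continuous_on J \<delta>"
      using * unfolding solution_on_def
      by (auto simp: continuous_on_eq_continuous_within intro: has_vector_derivative_continuous)
    then have contJ: "continuous_on {a..b} \<delta>" if "a \<in> J" "b \<in> J" for a b
      using continuous_on_subset is_interval_Icc_subset[OF intJ that] by blast
    \<comment> \<open>an extension would be bounded, and bounded away from \<open>0\<close>, on a compact interval reaching
       past an end of \<open>I\<close>, but \<open>x\<close> is unbounded at one end and the orbit tends to \<open>0\<close> at the other\<close>
    have "J \<subseteq> I"
    proof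
      fix s assume s: "s \<in> J"
      have T1: "T 1 \<in> I" "T 1 \<in> J" using TI[of 1] IJ by auto
      show "s \<in> I"
      proof (rule ccontr)
        assume sI: "s \<notin> I"
        consider "T 1 < s" | "s < T 1" using T1 sI by (cases "s = T 1") force+
        then show False
        proof cases
          case 1
          then obtain p where p: "p \<in> {T 1..s}" "\<And>t. t \<in> {T 1..s} \<Longrightarrow> norm (\<delta> p) \<le> norm (\<delta> t)"
            using continuous_attains_inf[of "{T 1..s}" "\<lambda>t. norm (\<delta> t)"]
              continuous_on_norm[OF contJ[OF T1(2) s]] by auto
          have "p \<in> J" using p(1) is_interval_Icc_subset[OF intJ T1(2) s] by blast
          then have "0 < norm (\<delta> p)" using J0[of p] by (simp add: zero_prod_def)
          then obtain b where b: "b > 0" "\<And>x. 0 < x \<Longrightarrow> x < b \<Longrightarrow> (x, - u x) \<in> ball 0 (norm (\<delta> p))"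
            using near0[of "ball 0 (norm (\<delta> p))"] by (auto simp flip: zero_prod_def)
          define x where "x = min 1 (b / 2)"
          have x: "0 < x" "x < b" "x \<le> 1" using b by (auto simp: x_def)
          have "T x < s"
            using is_interval_Icc_subset[OF intI T1(1) TI[OF x(1)]] sI 1
            by (meson atLeastAtMost_iff less_imp_le not_less subsetD)
          then have "norm (\<delta> p) \<le> norm (\<delta> (T x))" using T_le[of x 1] x by (intro p(2)) auto
          then show False using b(2)[OF x(1,2)] eq[OF TI[OF x(1)]] \<gamma>T[OF x(1)] by simp
        next
          case 2
          then obtain p where p: "\<forall>t\<in>{s..T 1}. fst (\<delta> t) \<le> fst (\<delta> p)"
            using continuous_attains_sup[of "{s..T 1}" "\<lambda>t. fst (\<delta> t)"]
              continuous_on_fst[OF contJ[OF s T1(2)]] by auto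
          define x where "x = max 1 (fst (\<delta> p) + 1)"
          have x: "0 < x" "1 \<le> x" "fst (\<delta> p) < x" by (auto simp: x_def)
          have "s < T x"
            using is_interval_Icc_subset[OF intI TI[OF x(1)] T1(1)] sI 2
            by (meson atLeastAtMost_iff less_imp_le not_less subsetD)
          then have "fst (\<delta> (T x)) \<le> fst (\<delta> p)" using T_le[of 1 x] x by (intro bspec[OF p]) auto
          then show False using x eq[OF TI[OF x(1)]] \<gamma>T[OF x(1)] by simp
        qed
      qed
    qed
    then show "J = I" using IJ by blast
  qed
  moreover have "\<gamma> ` I = graph_pos (\<lambda>x. - u x)"
    unfolding I_def graph_pos_def image_image by (auto simp: \<gamma>T)
  ultimately show ?thesis using that conv by blast
qed

lemma stable_manifold_eq_graph: "stable_manifold \<Lambda> \<alpha> c = graph_pos (\<lambda>x. - u x)"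
proof
  show "stable_manifold \<Lambda> \<alpha> c \<subseteq> graph_pos (\<lambda>x. - u x)"
  proof
    fix p assume "p \<in> stable_manifold \<Lambda> \<alpha> c"
    then obtain I \<gamma> t where "solution_on \<Lambda> \<alpha> c I \<gamma>" "converges_to_origin I \<gamma>" "t \<in> I" "p = \<gamma> t"
      unfolding stable_manifold_def trajectory_def by blast
    then have "0 < fst p" "snd p = - u (fst p)" using converging_solution_on_graph by blast+
    then show "p \<in> graph_pos (\<lambda>x. - u x)" unfolding graph_pos_def by (cases p) auto
  qed
  obtain I \<gamma> where \<gamma>: "trajectory \<Lambda> \<alpha> c I \<gamma>" "converges_to_origin I \<gamma>"
    "\<gamma> ` I = graph_pos (\<lambda>x. - u x)"
    by (rule trajectory_along_graph)
  then show "graph_pos (\<lambda>x. - u x) \<subseteq> stable_manifold \<Lambda> \<alpha> c"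
    unfolding stable_manifold_def \<gamma>(3)[symmetric] by blast
qed

end

section \<open>Position relative to \<open>L0\<close>, and the conclusion\<close>

context saddle
begin

lemma y0_tendsto_0: "((\<lambda>x. - y0 \<Lambda> \<alpha> x) \<longlongrightarrow> 0) (at_right 0)"
proof -
  have "continuous_on {0..} (\<lambda>x. - y0 \<Lambda> \<alpha> x)"
    unfolding y0_def using \<alpha> by (intro continuous_intros continuous_on_powr') auto
  then have "((\<lambda>x. - y0 \<Lambda> \<alpha> x) \<longlongrightarrow> - y0 \<Lambda> \<alpha> 0) (at 0 within {0..})"
    by (simp add: continuous_on)
  then have "((\<lambda>x. - y0 \<Lambda> \<alpha> x) \<longlongrightarrow> - y0 \<Lambda> \<alpha> 0) (at_right 0)"
    by (rule tendsto_within_subset) auto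
  then show ?thesis by (simp add: y0_def)
qed

text \<open>At a contact point the nonnegative difference \<open>- y0 - u\<close> has a local
  minimum, so its derivative vanishes; but there it equals \<open>c / \<Lambda> > 0\<close>.\<close>

lemma above_y0:
  assumes c: "0 < c" and x: "0 < x"
    and u: "\<And>x. 0 < x \<Longrightarrow> u x \<le> - y0 \<Lambda> \<alpha> x"
      "(u has_real_derivative slope x (u x)) (at x)"
  shows "u x < - y0 \<Lambda> \<alpha> x"
proof (rule ccontr)
  assume "\<not> ?thesis"
  then have eq: "u x = - y0 \<Lambda> \<alpha> x" using u(1)[OF x] by simp
  have "((\<lambda>x. - y0 \<Lambda> \<alpha> x - u x) has_real_derivative
      x powr \<alpha> / (\<Lambda> * - y0 \<Lambda> \<alpha> x) - slope x (u x)) (at x)"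
    using y0_deriv[OF x] u(2) by (rule DERIV_diff)
  then have "x powr \<alpha> / (\<Lambda> * - y0 \<Lambda> \<alpha> x) - slope x (u x) = 0"
    by (rule DERIV_local_min[OF _ x]) (use u(1) eq in auto)
  then show False using c \<Lambda> unfolding slope_def eq by simp
qed

end

theorem lemma4p7:
  fixes \<Lambda> \<alpha> c :: real
  assumes "\<Lambda> > 0" and "0 \<le> \<alpha>" and "\<alpha> \<le> 1" and "c \<ge> 0"
  shows "(\<exists>I \<gamma> y.
            trajectory \<Lambda> \<alpha> c I \<gamma> \<and> converges_to_origin I \<gamma> \<and>
            stable_manifold \<Lambda> \<alpha> c = \<gamma> ` I \<and>
            \<gamma> ` I = graph_pos y \<and>
            real_analytic_on y {0<..} \<and>
            y 0 = 0 \<and> continuous_on {0..} y \<and>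
            (\<forall>x>0. y x < 0) \<and>
            (c > 0 \<longrightarrow> (\<forall>x>0. y0 \<Lambda> \<alpha> x < y x)) \<and>
            (c = 0 \<longrightarrow> (\<forall>x>0. y x = y0 \<Lambda> \<alpha> x))) \<and>
         L0 \<Lambda> \<alpha> = graph_pos (y0 \<Lambda> \<alpha>)"
proof -
  interpret saddle \<Lambda> \<alpha> c by unfold_locales (use assms in auto)
  interpret S0: saddle \<Lambda> \<alpha> 0 by unfold_locales (use assms in auto)
  \<comment> \<open>For \<open>c = 0\<close> the explicit curve itself satisfies the separatrix
    conditions, so its graph is the whole stable manifold \<open>L0\<close>.\<close>
  interpret S0: separatrix \<Lambda> \<alpha> 0 "\<lambda>x. - y0 \<Lambda> \<alpha> x"
    by unfold_locales (use y0_neg y0_deriv y0_tendsto_0 in \<open>auto simp: S0.slope_def\<close>)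
  have L0: "stable_manifold \<Lambda> \<alpha> 0 = graph_pos (y0 \<Lambda> \<alpha>)"
    using S0.stable_manifold_eq_graph by simp
  obtain u where u: "\<And>x. 0 < x \<Longrightarrow> 0 < u x" "\<And>x. 0 < x \<Longrightarrow> u x \<le> - y0 \<Lambda> \<alpha> x"
    "\<And>x. 0 < x \<Longrightarrow> (u has_real_derivative slope x (u x)) (at x)"
    "real_analytic_on u {0<..}"
    using stable_solution by metis
  have ev: "\<forall>\<^sub>F x in at_right 0. 0 < (x::real)" by (rule eventually_at_right_less)
  have "(u \<longlongrightarrow> 0) (at_right 0)"
    by (rule tendsto_sandwich[OF eventually_mono[OF ev] eventually_mono[OF ev]
          tendsto_const y0_tendsto_0]) (simp_all add: u less_imp_le)
  then interpret separatrix \<Lambda> \<alpha> c u by unfold_locales (use u in auto)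
  define y where "y x = - (if 0 < x then u x else 0)" for x
  have y: "y x = - u x" if "0 < x" for x using that by (simp add: y_def)
  have graph: "graph_pos (\<lambda>x. - u x) = graph_pos y"
    unfolding graph_pos_def by (intro Collect_cong) (use y in auto)
  obtain I \<gamma> where \<gamma>: "trajectory \<Lambda> \<alpha> c I \<gamma>" "converges_to_origin I \<gamma>" "\<gamma> ` I = graph_pos y"
    using trajectory_along_graph[unfolded graph] .
  have "stable_manifold \<Lambda> \<alpha> c = \<gamma> ` I"
    using stable_manifold_eq_graph \<gamma>(3) graph by simp
  moreover have "real_analytic_on y {0<..}"
    by (rule real_analytic_on_cong[OF _ _ real_analytic_on_minus[OF u(4)]]) (use y in auto)
  moreover have "y 0 = 0" by (simp add: y_def)
  moreover have "continuous_on {0..} y"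
    unfolding y_def using isCont_extension
    by (intro continuous_at_imp_continuous_on ballI isCont_minus) auto
  moreover have "\<forall>x>0. y x < 0" using u(1) y by simp
  moreover have "\<forall>x>0. y0 \<Lambda> \<alpha> x < y x" if "c > 0"
  proof (intro allI impI)
    fix x :: real assume x: "0 < x"
    show "y0 \<Lambda> \<alpha> x < y x" using above_y0[OF that x u(2) u(3)[OF x]] y[OF x] by simp
  qed
  moreover have "\<forall>x>0. y x = y0 \<Lambda> \<alpha> x" if "c = 0"
  proof (intro allI impI)
    fix x :: real assume "0 < x"
    \<comment> \<open>For \<open>c = 0\<close> both graphs equal the same stable manifold, so the
      limit solution and \<open>y0\<close> coincide.\<close>
    then have "(x, y x) \<in> graph_pos y" by (auto simp: graph_pos_def)
    also have "graph_pos y = graph_pos (y0 \<Lambda> \<alpha>)"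
      using stable_manifold_eq_graph graph L0 that by simp
    finally show "y x = y0 \<Lambda> \<alpha> x" by (auto simp: graph_pos_def)
  qed
  ultimately show ?thesis using \<gamma> L0 unfolding L0_def
    by (intro conjI exI[of _ I] exI[of _ \<gamma>] exI[of _ y]) simp_all
qed

end
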